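(* Let $T$ be the Galton–Watson tree described in the context (with minimal offspring number $\mu\ge 1$). As $\varepsilon\downarrow 0$, conditionally on the event $\{W<\varepsilon\}$ the tree $T$ converges in law on $(\mathcal{T},d)$ to the regular $\mu$-ary tree, i.e. the tree in which every vertex has exactly $\mu$ offspring.
   Context: $T$ is a Galton–Watson tree with generation sizes $(Z_n)_{n\ge0}$, $Z_0=1$, whose offspring variable $N$ is nondegenerate (not almost surely constant), with $P(N=0)=0$ and $E[N\log N]<\infty$. Put $a:=E[N]\in(1,\infty)$ and $\mu:=\min\{n\in\mathbb{N}:P(N=n)>0\}$. The martingale limit $W:=\lim_{n\to\infty}Z_n/a^n$ exists and is strictly positive almost surely. $\mathcal{T}$ denotes the space of all rooted trees in which every vertex has finite degree, with the metric $d$ determined by $d(T_1,T_2)=e^{-n}$, where $n$ is maximal such that $T_1$ and $T_2$ coincide up to the $n$th generation (and $d(T_1,T_2)=0$ if $T_1=T_2$); $(\mathcal{T},d)$ is a complete separable metric space. *)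

theory Defs
  imports "HOL-Probability.Probability"
begin
text \<open>Trees are plane trees in Ulam--Harris notation: the root is the empty word, and the children
  of a vertex v with k offspring are the words \<open>v @ [0], \<dots>, v @ [k - 1]\<close>.\<close>

typedef rtree =
  "{t :: nat list set. [] \<in> t
      \<and> (\<forall>v i. v @ [i] \<in> t \<longrightarrow> v \<in> t \<and> (\<forall>j<i. v @ [j] \<in> t))
      \<and> (\<forall>v. finite {i. v @ [i] \<in> t})}"
  morphisms vertices Abs_rtree
proof
  show "{[]} \<in> {t :: nat list set. [] \<in> t
      \<and> (\<forall>v i. v @ [i] \<in> t \<longrightarrow> v \<in> t \<and> (\<forall>j<i. v @ [j] \<in> t))
      \<and> (\<forall>v. finite {i. v @ [i] \<in> t})}"
    by auto
qed

definition offspring :: "rtree \<Rightarrow> nat list \<Rightarrow> nat" where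
  "offspring t v = card {i. v @ [i] \<in> vertices t}"

definition generation :: "nat \<Rightarrow> rtree \<Rightarrow> nat list set" where
  "generation n t = {v \<in> vertices t. length v = n}"

definition gen_size :: "nat \<Rightarrow> rtree \<Rightarrow> nat" where
  "gen_size n t = card (generation n t)"

definition coincide_upto :: "nat \<Rightarrow> rtree \<Rightarrow> rtree \<Rightarrow> bool" where
  "coincide_upto n s t \<longleftrightarrow> (\<forall>k\<le>n. generation k s = generation k t)"

lemma coincide_upto_0: "coincide_upto 0 s t"
proof -
  have "[] \<in> vertices s" "[] \<in> vertices t"
    using vertices[of s] vertices[of t] by auto
  then show ?thesis by (auto simp: coincide_upto_def generation_def)
qed

lemma coincide_upto_mono: "coincide_upto n s t \<Longrightarrow> m \<le> n \<Longrightarrow> coincide_upto m s t"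
  by (auto simp: coincide_upto_def)

lemma coincide_upto_sym: "coincide_upto n s t \<longleftrightarrow> coincide_upto n t s"
  by (metis coincide_upto_def)

lemma coincide_upto_trans: "coincide_upto n s t \<Longrightarrow> coincide_upto n t u \<Longrightarrow> coincide_upto n s u"
  by (metis coincide_upto_def)

lemma coincide_upto_all: "(\<And>n. coincide_upto n s t) \<Longrightarrow> s = t"
proof -
  assume "\<And>n. coincide_upto n s t"
  then have "\<And>n. generation n s = generation n t" by (auto simp: coincide_upto_def)
  then have "vertices s = vertices t" by (auto simp: generation_def set_eq_iff)
  then show "s = t" by (simp add: vertices_inject)
qed

instantiation rtree :: metric_space
begin

definition dist_rtree :: "rtree \<Rightarrow> rtree \<Rightarrow> real" where
  "dist s t = (if s = t then 0 else exp (- real (GREATEST n. coincide_upto n s t)))"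

definition uniformity_rtree :: "(rtree \<times> rtree) filter" where
  "uniformity_rtree = (INF e\<in>{0<..}. principal {(x, y). dist x y < e})"

definition open_rtree :: "rtree set \<Rightarrow> bool" where
  "open_rtree U \<longleftrightarrow> (\<forall>x\<in>U. \<forall>\<^sub>F (x', y) in uniformity. x' = x \<longrightarrow> y \<in> U)"

lemma coincide_upto_Greatest_iff:
  assumes "s \<noteq> t"
  shows "coincide_upto n s t \<longleftrightarrow> n \<le> (GREATEST n. coincide_upto n s t)"
proof -
  obtain b where b: "\<not> coincide_upto b s t" using assms coincide_upto_all by blast
  have bd: "\<And>k. coincide_upto k s t \<Longrightarrow> k \<le> b"
    using b coincide_upto_mono nat_le_linear by blast
  have "coincide_upto (GREATEST n. coincide_upto n s t) s t"
    using GreatestI_nat[of "\<lambda>n. coincide_upto n s t" 0 b] coincide_upto_0 bd by blast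
  then show ?thesis
    using Greatest_le_nat[of "\<lambda>n. coincide_upto n s t" n b] bd coincide_upto_mono by blast
qed

lemma dist_rtree_le_iff: "dist s t \<le> exp (- real n) \<longleftrightarrow> coincide_upto n s t" for s t :: rtree
proof (cases "s = t")
  case True
  then show ?thesis by (simp add: dist_rtree_def coincide_upto_def)
next
  case False
  then show ?thesis by (simp add: dist_rtree_def coincide_upto_Greatest_iff[of s t n])
qed

instance
proof
  show "uniformity = (INF e\<in>{0<..}. principal {(x :: rtree, y). dist x y < e})"
    by (rule uniformity_rtree_def)
  show "open U \<longleftrightarrow> (\<forall>x\<in>U. \<forall>\<^sub>F (x', y) in uniformity. x' = x \<longrightarrow> y \<in> U)" for U :: "rtree set"
    by (rule open_rtree_def)
next
  fix x y z :: rtree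
  show "dist x y = 0 \<longleftrightarrow> x = y" by (simp add: dist_rtree_def)
  show "dist x y \<le> dist x z + dist y z"
  proof (cases "x = y \<or> x = z \<or> y = z")
    case True
    have nonneg: "0 \<le> dist u v" for u v :: rtree by (simp add: dist_rtree_def)
    have self: "dist u u = 0" for u :: rtree by (simp add: dist_rtree_def)
    have sym: "dist x y = dist y x"
      unfolding dist_rtree_def by (simp only: coincide_upto_sym[of _ y x] eq_commute[of y x])
    from True consider "x = y" | "x = z" | "y = z" by blast
    then show ?thesis
    proof cases
      case 1
      then show ?thesis using nonneg[of y z] self[of y] by simp
    next
      case 2
      then show ?thesis using sym self[of x] by simp
    next
      case 3
      then show ?thesis using self[of y] by simp
    qed
  next
    case False
    define m where "m = (GREATEST n. coincide_upto n x z)"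
    define k where "k = (GREATEST n. coincide_upto n y z)"
    have m: "coincide_upto m x z"
      using False by (subst coincide_upto_Greatest_iff) (simp_all add: m_def)
    have k: "coincide_upto k y z"
      using False by (subst coincide_upto_Greatest_iff) (simp_all add: k_def)
    have "coincide_upto (min m k) x z" "coincide_upto (min m k) y z"
      by (rule coincide_upto_mono[OF m], simp) (rule coincide_upto_mono[OF k], simp)
    then have "coincide_upto (min m k) x y"
      using coincide_upto_sym coincide_upto_trans by metis
    then have "dist x y \<le> exp (- real (min m k))" by (simp add: dist_rtree_le_iff)
    also have "\<dots> \<le> exp (- real m) + exp (- real k)" by (auto simp: min_def)
    also have "\<dots> = dist x z + dist y z" using False by (simp add: dist_rtree_def m_def k_def)
    finally show ?thesis .
  qed
qed

end

text \<open>The tree in which each vertex v has \<open>\<xi> v\<close> offspring (the values of \<open>\<xi>\<close> at words that are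
  not vertices are irrelevant).\<close>

definition tree_of :: "(nat list \<Rightarrow> nat) \<Rightarrow> rtree" where
  "tree_of \<xi> = Abs_rtree {v. \<forall>k<length v. v ! k < \<xi> (take k v)}"

lemma vertices_tree_of: "vertices (tree_of \<xi>) = {v. \<forall>k<length v. v ! k < \<xi> (take k v)}"
proof -
  have snoc: "(\<forall>k<length (v @ [i]). (v @ [i]) ! k < \<xi> (take k (v @ [i])))
      \<longleftrightarrow> (\<forall>k<length v. v ! k < \<xi> (take k v)) \<and> i < \<xi> v" for v i
    by (auto simp: nth_append less_Suc_eq)
  define t where "t = {v. \<forall>k<length v. v ! k < \<xi> (take k v)}"
  have mem: "v @ [i] \<in> t \<longleftrightarrow> v \<in> t \<and> i < \<xi> v" for v i
    unfolding t_def mem_Collect_eq snoc ..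
  have "{i. v @ [i] \<in> t} \<subseteq> {..<\<xi> v}" for v
    by (auto simp: mem)
  then have fin: "finite {i. v @ [i] \<in> t}" for v
    by (rule finite_subset) simp
  have "[] \<in> t" by (simp add: t_def)
  then have "vertices (Abs_rtree t) = t"
    by (intro Abs_rtree_inverse) (simp add: mem)
  then show ?thesis by (simp add: tree_of_def t_def)
qed

lemma offspring_tree_of: "v \<in> vertices (tree_of \<xi>) \<Longrightarrow> offspring (tree_of \<xi>) v = \<xi> v"
proof -
  assume "v \<in> vertices (tree_of \<xi>)"
  then have "{i. v @ [i] \<in> vertices (tree_of \<xi>)} = {..<\<xi> v}"
    unfolding vertices_tree_of by (auto simp: nth_append less_Suc_eq)
  then show ?thesis by (simp add: offspring_def)
qed

definition regular_tree :: "nat \<Rightarrow> rtree" where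
  "regular_tree m = tree_of (\<lambda>_. m)"

definition galton_watson_law :: "nat pmf \<Rightarrow> rtree measure" where
  "galton_watson_law p = distr (\<Pi>\<^sub>M v\<in>UNIV. measure_pmf p) borel tree_of"

definition galton_watson_tree :: "'a measure \<Rightarrow> nat pmf \<Rightarrow> ('a \<Rightarrow> rtree) \<Rightarrow> bool" where
  "galton_watson_tree M p T \<longleftrightarrow>
     T \<in> borel_measurable M \<and> distr M borel T = galton_watson_law p"

definition offspring_mean :: "nat pmf \<Rightarrow> real" where
  "offspring_mean p = measure_pmf.expectation p real"

definition min_offspring :: "nat pmf \<Rightarrow> nat" where
  "min_offspring p = (LEAST n. pmf p n > 0)"

definition martingale_limit :: "nat pmf \<Rightarrow> rtree \<Rightarrow> real" where
  "martingale_limit p t = lim (\<lambda>n. real (gen_size n t) / offspring_mean p ^ n)"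

lemma finite_generation: "finite (generation n t)"
proof (induction n)
  case 0
  have "generation 0 t \<subseteq> {[]}" by (auto simp: generation_def)
  then show ?case using finite_subset by blast
next
  case (Suc n)
  have fin: "finite {i. v @ [i] \<in> vertices t}" for v using vertices[of t] by auto
  have "generation (Suc n) t \<subseteq>
      (\<Union>v\<in>generation n t. (\<lambda>i. v @ [i]) ` {i. v @ [i] \<in> vertices t})"
  proof
    fix w assume w: "w \<in> generation (Suc n) t"
    then obtain v i where vi: "w = v @ [i]"
      by (cases w rule: rev_cases) (auto simp: generation_def)
    then have "v \<in> vertices t" using w vertices[of t] by (auto simp: generation_def)
    then show "w \<in> (\<Union>v\<in>generation n t. (\<lambda>i. v @ [i]) ` {i. v @ [i] \<in> vertices t})"
      using w vi by (auto simp: generation_def)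
  qed
  then show ?case using Suc fin by (meson finite_UN finite_imageI finite_subset)
qed

text \<open>\<open>distr\<close> is the null measure for a non-measurable map, so the definition of
  \<open>galton_watson_law\<close> is meaningful only because \<open>tree_of\<close> is measurable.\<close>

lemma measurable_tree_of: "tree_of \<in> borel_measurable (\<Pi>\<^sub>M v\<in>UNIV. measure_pmf p)"
proof (rule borel_measurableI)
  fix U :: "rtree set" assume U: "open U"
  let ?P = "\<Pi>\<^sub>M v\<in>(UNIV :: nat list set). measure_pmf p"
  define up where "up n t = {v \<in> vertices t. length v \<le> n}" for n t
  have up_fin: "finite (up n t)" for n t
  proof -
    have "up n t = (\<Union>k\<le>n. generation k t)" by (auto simp: up_def generation_def)
    then show ?thesis by (simp add: finite_generation)
  qed
  have up_eq: "up n s = up n t \<longleftrightarrow> coincide_upto n s t" for n s t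
  proof
    assume eq: "up n s = up n t"
    have "generation k u = {v \<in> up n u. length v = k}" if "k \<le> n" for k u
      using that by (auto simp: up_def generation_def)
    then show "coincide_upto n s t" using eq by (simp add: coincide_upto_def)
  next
    assume "coincide_upto n s t"
    moreover have "up n u = (\<Union>k\<le>n. generation k u)" for u
      by (auto simp: up_def generation_def)
    ultimately show "up n s = up n t" by (simp add: coincide_upto_def)
  qed
  define C where "C = {(n, F). finite F \<and> (\<forall>s. up n s = F \<longrightarrow> s \<in> U)}"
  have "countable {F :: nat list set. finite F}" by (rule countable_Collect_finite)
  then have "countable (UNIV \<times> {F :: nat list set. finite F} :: (nat \<times> _) set)" by auto
  then have cC: "countable C" by (rule countable_subset[rotated]) (auto simp: C_def)
  have U_eq: "U = (\<Union>(n, F)\<in>C. {s. up n s = F})"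
  proof (intro equalityI subsetI)
    fix t assume t: "t \<in> U"
    then obtain e where e: "e > 0" "\<And>s. dist s t < e \<Longrightarrow> s \<in> U"
      using U unfolding open_dist by blast
    obtain n where "1 / real (Suc n) < e" using e(1) nat_approx_posE by blast
    moreover have "exp (- real n) \<le> 1 / real (Suc n)"
      using exp_ge_add_one_self[of "real n"] by (simp add: exp_minus field_simps)
    ultimately have "exp (- real n) < e" by linarith
    then have "s \<in> U" if "up n s = up n t" for s
      using that e(2)[of s] dist_rtree_le_iff[of s t n] unfolding up_eq by linarith
    then have "(n, up n t) \<in> C" using up_fin by (auto simp: C_def)
    then show "t \<in> (\<Union>(n, F)\<in>C. {s. up n s = F})" by blast
  qed (auto simp: C_def)
  have comp: "(\<lambda>x. x v) \<in> ?P \<rightarrow>\<^sub>M count_space UNIV" for v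
    using measurable_component_singleton[of v UNIV "\<lambda>_. measure_pmf p"]
    by (simp add: measurable_def)
  have mem: "Measurable.pred ?P (\<lambda>x. v \<in> vertices (tree_of x))" for v
  proof -
    have "Measurable.pred ?P (\<lambda>x. \<forall>k\<in>{..<length v}. v ! k < x (take k v))"
    proof (rule pred_intros_finite)
      fix k
      show "Measurable.pred ?P (\<lambda>x. v ! k < x (take k v))"
        using measurable_compose[OF comp, of "\<lambda>y. v ! k < y"] by simp
    qed simp
    then show ?thesis by (simp add: vertices_tree_of Ball_def)
  qed
  have "Measurable.pred ?P (\<lambda>x. \<forall>v. (v \<in> vertices (tree_of x) \<and> length v \<le> n) = (v \<in> F))" for n F
    using mem by measurable
  then have cyl: "Measurable.pred ?P (\<lambda>x. up n (tree_of x) = F)" for n F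
    by (simp add: up_def set_eq_iff)
  have "tree_of -` U \<inter> space ?P = (\<Union>(n, F)\<in>C. {x \<in> space ?P. up n (tree_of x) = F})"
    by (subst U_eq) auto
  also have "\<dots> \<in> sets ?P"
    using cyl by (intro sets.countable_UN' cC) (auto simp: pred_def)
  finally show "tree_of -` U \<inter> space ?P \<in> sets ?P" .
qed

definition converges_in_law ::
    "('i \<Rightarrow> 'b::metric_space measure) \<Rightarrow> 'b measure \<Rightarrow> 'i filter \<Rightarrow> bool" where
  "converges_in_law \<nu> \<rho> F \<longleftrightarrow>
     (\<forall>f :: 'b \<Rightarrow> real. continuous_on UNIV f \<and> bounded (range f) \<longrightarrow>
        ((\<lambda>i. integral\<^sup>L (\<nu> i) f) \<longlongrightarrow> integral\<^sup>L \<rho> f) F)"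

definition conditional_law :: "'a measure \<Rightarrow> 'a set \<Rightarrow> ('a \<Rightarrow> 'b::topological_space) \<Rightarrow> 'b measure" where
  "conditional_law M A X = distr (uniform_measure M A) borel X"

end

theory Submission
  imports Defs
begin

text \<open>Condition on generation \<open>n\<close> and write \<open>A\<^sub>0\<close> for the \<open>n\<close>-th generation of the \<open>\<mu>\<close>-ary tree and
  \<open>x = a\<^sup>n \<epsilon>\<close>. If generation \<open>n\<close> is the set \<open>A\<close>, then \<open>W < \<epsilon>\<close> means \<open>\<Sum>v\<in>A. W\<^sub>v < x\<close>, where the limits \<open>W\<^sub>v\<close>
  of the subtrees are independent copies of \<open>W\<close>. Almost surely \<open>A\<^sub>0 \<subseteq> A\<close>; if the inclusion is
  strict, then some further independent \<open>W\<^sub>v\<close> has to be below \<open>x\<close> as well. Hence the conditional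
  probability of \<open>A \<noteq> A\<^sub>0\<close> given \<open>W < \<epsilon>\<close> is at most \<open>P(W < x) / P(A = A\<^sub>0)\<close>, which tends to 0 because
  \<open>W > 0\<close> almost surely.

  Convergence and positivity (the Kesten--Stigum theorem) do not need martingale theory here:
  truncating the offspring numbers of generation \<open>n\<close> at the exponentially smaller level \<open>a\<close>
  to the power \<open>n/2\<close>, rather than at \<open>a\<^sup>n\<close>, makes the second moments decay exponentially, while
  \<open>E[N log N] < \<infinity>\<close> still makes the tails summable, so the increments of \<open>Z\<^sub>n / a\<^sup>n\<close> are summable
  in \<open>L\<^sup>1\<close>.\<close>

section \<open>Independence of functions of disjoint sets of coordinates\<close>

text \<open>Dependence on a set of coordinates is stated for functions on the full product space, so
  that events about different subtrees live on one space and need no change of domain.\<close>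

definition depends_on :: "'i set \<Rightarrow> (('i \<Rightarrow> 'b) \<Rightarrow> 'c) \<Rightarrow> bool" where
  "depends_on K f \<longleftrightarrow> (\<forall>x y. (\<forall>i\<in>K. x i = y i) \<longrightarrow> f x = f y)"

lemma depends_onD: "depends_on K f \<Longrightarrow> (\<And>i. i \<in> K \<Longrightarrow> x i = y i) \<Longrightarrow> f x = f y"
  by (auto simp: depends_on_def)

lemma depends_on_indicator:
  fixes f :: "('i \<Rightarrow> 'b) \<Rightarrow> 'c"
  assumes "depends_on K f"
  shows "depends_on K (indicator {x. Q (f x)})"
  unfolding depends_on_def
proof (intro allI impI)
  fix x y :: "'i \<Rightarrow> 'b" assume "\<forall>i\<in>K. x i = y i"
  then have "f x = f y" by (intro depends_onD[OF assms]) blast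
  then show "indicator {x. Q (f x)} x = indicator {x. Q (f x)} y" by (simp add: indicator_def)
qed

lemma depends_on_comp: "depends_on K f \<Longrightarrow> depends_on K (\<lambda>x. g (f x))"
  unfolding depends_on_def by metis

lemma depends_on_comp2:
  "depends_on K f \<Longrightarrow> depends_on K g \<Longrightarrow> depends_on K (\<lambda>x. c (f x) (g x))"
  unfolding depends_on_def by metis

lemma depends_on_mono: "depends_on K f \<Longrightarrow> K \<subseteq> L \<Longrightarrow> depends_on L f"
  unfolding depends_on_def by blast

text \<open>The coordinates are independent, so their restrictions to disjoint blocks
  \<open>K j\<close> are too, and each \<open>f j\<close> factors through its block.\<close>

lemma indep_vars_PiM_depends_on:
  fixes M :: "'i \<Rightarrow> 'b measure"
  assumes M: "\<And>i. prob_space (M i)" "\<And>i. space (M i) = UNIV"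
    and f: "\<And>j. j \<in> J \<Longrightarrow> f j \<in> PiM UNIV M \<rightarrow>\<^sub>M N j"
    and dep: "\<And>j. j \<in> J \<Longrightarrow> depends_on (K j) (f j)"
    and disj: "disjoint_family_on K J"
  shows "prob_space.indep_vars (PiM UNIV M) N f J"
proof -
  interpret prob_space "PiM UNIV M" by (intro prob_space_PiM M)
  interpret pp: product_prob_space M UNIV
    using M(1) by (simp add: product_prob_space_def product_prob_space_axioms_def
        product_sigma_finite_def prob_space_imp_sigma_finite)
  have coord: "indep_vars M (\<lambda>i x. x i) UNIV"
  proof (subst indep_vars_iff_distr_eq_PiM)
    have "distr (PiM UNIV M) (PiM UNIV M) (\<lambda>x. \<lambda>i\<in>UNIV. x i) = PiM UNIV M"
      by (simp add: restrict_UNIV distr_id)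
    also have "\<dots> = (\<Pi>\<^sub>M i\<in>UNIV. distr (PiM UNIV M) (M i) (\<lambda>x. x i))"
      using pp.PiM_component by simp
    finally show "distr (PiM UNIV M) (PiM UNIV M) (\<lambda>x. \<lambda>i\<in>UNIV. x i) = \<dots>" .
  qed auto
  have "indep_vars (\<lambda>j. PiM (K j) M) (\<lambda>j x. restrict x (K j)) J"
    using indep_vars_restrict[OF coord _ disj] by simp
  moreover have "f j \<in> PiM (K j) M \<rightarrow>\<^sub>M N j" if "j \<in> J" for j
  proof -
    \<comment> \<open>A point restricted to \<open>K j\<close> takes the value
      \<open>undefined\<close> elsewhere. It is still a point of the full product, because every
      factor has \<open>UNIV\<close> as its space, so \<open>f j\<close> may be evaluated
      there.\<close>
    have "(\<lambda>x. x) \<in> PiM (K j) M \<rightarrow>\<^sub>M PiM UNIV M"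
    proof (rule measurable_PiM_single')
      fix i
      show "(\<lambda>x. x i) \<in> PiM (K j) M \<rightarrow>\<^sub>M M i"
      proof (cases "i \<in> K j")
        case False
        then have "(\<lambda>x. x i) \<in> PiM (K j) M \<rightarrow>\<^sub>M M i \<longleftrightarrow> (\<lambda>x. undefined) \<in> PiM (K j) M \<rightarrow>\<^sub>M M i"
          by (intro measurable_cong) (auto simp: space_PiM PiE_def extensional_def)
        then show ?thesis using M(2) by simp
      qed simp
    qed (auto simp: M(2))
    from measurable_compose[OF this f[OF that]] show ?thesis .
  qed
  ultimately have "indep_vars N (\<lambda>j x. f j (restrict x (K j))) J"
    by (rule indep_vars_compose2)
  moreover have "f j (restrict x (K j)) = f j x" if "j \<in> J" for j x
    using dep[OF that] by (rule depends_onD) simp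
  ultimately show ?thesis
    by (subst (asm) indep_vars_cong) auto
qed

lemma nn_integral_PiM_prod_depends_on:
  fixes M :: "'i \<Rightarrow> 'b measure" and f :: "'j \<Rightarrow> ('i \<Rightarrow> 'b) \<Rightarrow> ennreal"
  assumes M: "\<And>i. prob_space (M i)" "\<And>i. space (M i) = UNIV" and J: "finite J"
    and f: "\<And>j. j \<in> J \<Longrightarrow> f j \<in> borel_measurable (PiM UNIV M)"
    and dep: "\<And>j. j \<in> J \<Longrightarrow> depends_on (K j) (f j)"
    and disj: "disjoint_family_on K J"
  shows "(\<integral>\<^sup>+x. (\<Prod>j\<in>J. f j x) \<partial>PiM UNIV M) = (\<Prod>j\<in>J. \<integral>\<^sup>+x. f j x \<partial>PiM UNIV M)"
proof -
  interpret prob_space "PiM UNIV M" by (intro prob_space_PiM M)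
  have "indep_vars (\<lambda>_. borel) f J"
    using assms by (intro indep_vars_PiM_depends_on)
  then show ?thesis using J by (intro indep_vars_nn_integral) auto
qed

lemma nn_integral_PiM_mult_depends_on:
  fixes M :: "'i \<Rightarrow> 'b measure" and f g :: "('i \<Rightarrow> 'b) \<Rightarrow> ennreal"
  assumes M: "\<And>i. prob_space (M i)" "\<And>i. space (M i) = UNIV"
    and f: "f \<in> borel_measurable (PiM UNIV M)" "depends_on K f"
    and g: "g \<in> borel_measurable (PiM UNIV M)" "depends_on L g"
    and disj: "K \<inter> L = {}"
  shows "(\<integral>\<^sup>+x. f x * g x \<partial>PiM UNIV M) = (\<integral>\<^sup>+x. f x \<partial>PiM UNIV M) * (\<integral>\<^sup>+x. g x \<partial>PiM UNIV M)"
proof -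
  \<comment> \<open>The two-factor case is the finite family indexed by \<open>bool\<close>.\<close>
  have "(\<integral>\<^sup>+x. (\<Prod>b\<in>UNIV. case_bool f g b x) \<partial>PiM UNIV M)
      = (\<Prod>b\<in>UNIV. \<integral>\<^sup>+x. case_bool f g b x \<partial>PiM UNIV M)"
    using f g disj
    by (intro nn_integral_PiM_prod_depends_on[where K = "case_bool K L"] M)
      (auto simp: disjoint_family_on_def split: bool.split)
  then show ?thesis by (simp add: UNIV_bool mult.commute)
qed

subsection \<open>Generations and subtrees\<close>

lemma Nil_in_vertices: "[] \<in> vertices t"
  using vertices[of t] by auto

lemma generation_tree_of:
  "generation n (tree_of \<xi>) = {v. length v = n \<and> (\<forall>k<n. v ! k < \<xi> (take k v))}"
  by (auto simp: generation_def vertices_tree_of)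

text \<open>The environment re-rooted at \<open>v\<close>. It is defined for every word, vertex of
  the tree or not, which makes its law and its independence properties unconditional.\<close>

definition subenv :: "nat list \<Rightarrow> (nat list \<Rightarrow> 'b) \<Rightarrow> nat list \<Rightarrow> 'b" where
  "subenv v \<xi> = (\<lambda>u. \<xi> (v @ u))"

text \<open>The letter condition for \<open>v @ u\<close> splits into one on the first
  \<open>n\<close> letters and one on the last \<open>k\<close>. The prefixes in the second are
  \<open>v\<close> followed by prefixes of \<open>u\<close>, which is what \<open>subenv v\<close>
  reads.\<close>

lemma append_in_generation:
  assumes "length v = n"
  shows "v @ u \<in> generation (n + k) (tree_of \<xi>) \<longleftrightarrow>
    v \<in> generation n (tree_of \<xi>) \<and> u \<in> generation k (tree_of (subenv v \<xi>))" 
proof -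
  have "(\<forall>j<n + k. (v @ u) ! j < \<xi> (take j (v @ u))) \<longleftrightarrow>
      (\<forall>j<n. v ! j < \<xi> (take j v)) \<and> (\<forall>j<k. u ! j < \<xi> (v @ take j u))" (is "?L \<longleftrightarrow> ?R")
  proof
    assume L: ?L
    show ?R
    proof (intro conjI allI impI)
      fix j assume j: "j < n"
      then have "(v @ u) ! j < \<xi> (take j (v @ u))" using L by simp
      then show "v ! j < \<xi> (take j v)" using j assms by (simp add: nth_append)
    next
      fix j assume "j < k"
      then have "(v @ u) ! (n + j) < \<xi> (take (n + j) (v @ u))" using L by simp
      then show "u ! j < \<xi> (v @ take j u)" using assms by (simp add: nth_append)
    qed
  next
    assume R: ?R
    show ?L
    proof (intro allI impI)
      fix j assume j: "j < n + k"
      show "(v @ u) ! j < \<xi> (take j (v @ u))"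
      proof (cases "j < n")
        case True
        then have "v ! j < \<xi> (take j v)" using R by blast
        then show ?thesis using True assms by (simp add: nth_append)
      next
        case False
        then have "j - n < k" using j by linarith
        then have "u ! (j - n) < \<xi> (v @ take (j - n) u)" using R by blast
        then show ?thesis using False assms by (simp add: nth_append)
      qed
    qed
  qed
  then have "length (v @ u) = n + k \<and> (\<forall>j<n + k. (v @ u) ! j < \<xi> (take j (v @ u))) \<longleftrightarrow>
      (length v = n \<and> (\<forall>j<n. v ! j < \<xi> (take j v))) \<and> length u = k \<and> (\<forall>j<k. u ! j < \<xi> (v @ take j u))"
    using assms by (metis add_left_cancel length_append)
  then show ?thesis unfolding generation_tree_of subenv_def mem_Collect_eq .
qed

lemma generation_add:
  "generation (n + k) (tree_of \<xi>) =
    (\<Union>v\<in>generation n (tree_of \<xi>). (@) v ` generation k (tree_of (subenv v \<xi>)))" (is "_ = ?R")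
proof (intro equalityI subsetI)
  fix w assume w: "w \<in> generation (n + k) (tree_of \<xi>)"
  then have "length (take n w) = n" by (simp add: generation_def)
  then have "take n w \<in> generation n (tree_of \<xi>) \<and> drop n w \<in> generation k (tree_of (subenv (take n w) \<xi>))"
    using append_in_generation[of "take n w" n "drop n w" k \<xi>] w
    unfolding append_take_drop_id by blast
  moreover have "w = take n w @ drop n w" by simp
  ultimately show "w \<in> ?R" by blast
next
  fix w assume "w \<in> ?R"
  then obtain v u where *: "v \<in> generation n (tree_of \<xi>)" "u \<in> generation k (tree_of (subenv v \<xi>))" "w = v @ u"
    by blast
  then have "length v = n" by (simp add: generation_def)
  with * show "w \<in> generation (n + k) (tree_of \<xi>)"
    using append_in_generation by blast
qed

text \<open>Words with different prefixes of length \<open>n\<close> differ, so the subtrees rooted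
  in generation \<open>n\<close> contribute disjoint sets to generation
  \<open>n + k\<close>.\<close>

lemma gen_size_add:
  "gen_size (n + k) (tree_of \<xi>) =
    (\<Sum>v\<in>generation n (tree_of \<xi>). gen_size k (tree_of (subenv v \<xi>)))"
proof -
  have "card (generation (n + k) (tree_of \<xi>)) =
      (\<Sum>v\<in>generation n (tree_of \<xi>). card ((@) v ` generation k (tree_of (subenv v \<xi>))))"
    unfolding generation_add
  proof (intro card_UN_disjoint ballI impI finite_imageI finite_generation)
    fix v w assume "v \<in> generation n (tree_of \<xi>)" "w \<in> generation n (tree_of \<xi>)" "v \<noteq> w"
    moreover from this have "length v = length w" by (simp add: generation_def)
    ultimately show "(@) v ` generation k (tree_of (subenv v \<xi>)) \<inter>
        (@) w ` generation k (tree_of (subenv w \<xi>)) = {}" by auto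
  qed
  also have "\<dots> = (\<Sum>v\<in>generation n (tree_of \<xi>). card (generation k (tree_of (subenv v \<xi>))))"
    by (intro sum.cong card_image refl) (simp add: inj_on_def)
  finally show ?thesis by (simp add: gen_size_def)
qed

lemma generation_0: "generation 0 t = {[]}"
  using Nil_in_vertices by (auto simp: generation_def)

lemma gen_size_0: "gen_size 0 t = 1"
  by (simp add: gen_size_def generation_0)

lemma gen_size_1: "gen_size 1 (tree_of \<xi>) = \<xi> []"
proof -
  have "generation 1 (tree_of \<xi>) = (\<lambda>i. [i]) ` {..<\<xi> []}"
    by (auto simp: generation_tree_of length_Suc_conv)
  then show ?thesis by (simp add: gen_size_def card_image inj_on_def)
qed

lemma gen_size_Suc: "gen_size (Suc n) (tree_of \<xi>) = (\<Sum>v\<in>generation n (tree_of \<xi>). \<xi> v)"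
  using gen_size_add[of n 1 \<xi>] by (simp add: gen_size_1[unfolded One_nat_def] subenv_def)

lemma generation_Suc:
  "generation (Suc n) (tree_of \<xi>) = {v @ [i] | v i. v \<in> generation n (tree_of \<xi>) \<and> i < \<xi> v}"
proof -
  have "generation 1 (tree_of \<zeta>) = (\<lambda>i. [i]) ` {..<\<zeta> []}" for \<zeta>
    by (auto simp: generation_tree_of length_Suc_conv)
  then show ?thesis using generation_add[of n 1 \<xi>] by (auto simp: subenv_def)
qed

lemma generation_mono:
  assumes "\<And>u. \<xi> u \<le> \<zeta> u"
  shows "generation n (tree_of \<xi>) \<subseteq> generation n (tree_of \<zeta>)"
  using less_le_trans[OF _ assms] by (auto simp: generation_tree_of)

text \<open>Only the finitely many vertices of the regular tree before generation \<open>n\<close>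
  are constrained. For \<open>m\<close> equal to the least offspring number such a constraint has
  positive probability.\<close>

lemma generation_eq_regular:
  assumes "\<And>u k. k < n \<Longrightarrow> u \<in> generation k (regular_tree m) \<Longrightarrow> \<xi> u = m"
  shows "generation n (tree_of \<xi>) = generation n (regular_tree m)"
  using assms
proof (induction n)
  case (Suc n)
  have eq: "generation n (tree_of \<xi>) = generation n (regular_tree m)"
    by (rule Suc.IH) (rule Suc.prems[OF less_SucI])
  have "\<xi> v = m" if "v \<in> generation n (regular_tree m)" for v
    by (rule Suc.prems[OF lessI that])
  then show ?case
    unfolding generation_Suc eq by (auto simp: generation_Suc regular_tree_def)
qed (simp add: generation_0)

lemma card_generation_regular: "card (generation n (regular_tree m)) = m ^ n"
proof (induction n)
  case (Suc n)
  then show ?case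
    using gen_size_Suc[of n "\<lambda>_. m"] by (simp add: gen_size_def regular_tree_def)
qed (simp add: generation_0)

text \<open>Whether a word of length \<open>n\<close> is a vertex is decided at its proper
  prefixes.\<close>

lemma depends_on_generation: "depends_on {u. length u < n} (\<lambda>\<xi>. generation n (tree_of \<xi>))"
  unfolding depends_on_def
proof (intro allI impI)
  fix \<xi> \<zeta> :: "nat list \<Rightarrow> nat"
  assume "\<forall>u\<in>{u. length u < n}. \<xi> u = \<zeta> u"
  then have "\<xi> (take k v) = \<zeta> (take k v)" if "length v = n" "k < n" for v k
    using that by simp
  then show "generation n (tree_of \<xi>) = generation n (tree_of \<zeta>)"
    by (auto simp: generation_tree_of)
qed

lemma depends_on_subenv: "depends_on (range ((@) v)) (subenv v)"
  by (auto simp: depends_on_def subenv_def)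

lemma disjoint_ranges_append:
  "length v = length w \<Longrightarrow> v \<noteq> w \<Longrightarrow> range ((@) v) \<inter> range ((@) w) = {}"
  by auto

subsection \<open>Measurability\<close>

lemma open_generation_eq: "open {t. generation n t = A}"
  unfolding open_dist
proof (intro ballI)
  fix t assume t: "t \<in> {t. generation n t = A}"
  show "\<exists>e>0. \<forall>s. dist s t < e \<longrightarrow> s \<in> {t. generation n t = A}"
  proof (intro exI[of _ "exp (- real n)"] conjI allI impI)
    fix s assume "dist s t < exp (- real n)"
    then have "coincide_upto n s t" by (simp add: dist_rtree_le_iff[symmetric])
    then show "s \<in> {t. generation n t = A}" using t by (simp add: coincide_upto_def)
  qed simp
qed

text \<open>Generations are finite sets of words, hence take countably many values, and each fibre
  is open.\<close>

lemma measurable_generation: "generation n \<in> borel \<rightarrow>\<^sub>M count_space {A. finite A}"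
proof (subst measurable_count_space_eq_countable)
  show "countable {A :: nat list set. finite A}" by (rule countable_Collect_finite)
qed (use open_generation_eq[of n] in \<open>auto simp: finite_generation vimage_def\<close>)

lemma measurable_gen_size [measurable]: "gen_size n \<in> borel \<rightarrow>\<^sub>M count_space UNIV"
  unfolding gen_size_def[abs_def]
  by (rule measurable_compose[OF measurable_generation]) simp

lemma borel_measurable_martingale_limit [measurable]: "martingale_limit p \<in> borel_measurable borel"
  unfolding martingale_limit_def[abs_def] by measurable

subsection \<open>The product law of the offspring numbers\<close>

abbreviation env :: "nat pmf \<Rightarrow> (nat list \<Rightarrow> nat) measure" where
  "env p \<equiv> \<Pi>\<^sub>M v\<in>UNIV. measure_pmf p"

lemma prob_space_env: "prob_space (env p)"
  by (intro prob_space_PiM prob_space_measure_pmf)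

lemma space_env [simp]: "space (env p) = UNIV"
  by (simp add: space_PiM)

lemma measurable_env_coord [measurable]: "(\<lambda>\<xi>. \<xi> v) \<in> env p \<rightarrow>\<^sub>M count_space UNIV"
  using measurable_component_singleton[of v UNIV "\<lambda>_. measure_pmf p"]
  by (simp add: measurable_def)

lemma measurable_subenv [measurable]: "subenv v \<in> env p \<rightarrow>\<^sub>M env p"
  unfolding subenv_def[abs_def] by (rule measurable_PiM_single') auto

text \<open>Prefixing by \<open>v\<close> is injective, so \<open>subenv v\<close> merely selects
  and relabels coordinates of an i.i.d. family.\<close>

lemma distr_subenv: "distr (env p) (env p) (subenv v) = env p"
  using distr_PiM_reindex[of UNIV "\<lambda>_. measure_pmf p" "(@) v" UNIV]
  by (simp add: prob_space_measure_pmf restrict_UNIV subenv_def[abs_def] inj_def)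

lemma distr_env_coord: "distr (env p) (measure_pmf p) (\<lambda>\<xi>. \<xi> v) = measure_pmf p"
  using distr_PiM_component[of UNIV "\<lambda>_. measure_pmf p" v] by (simp add: prob_space_measure_pmf)

lemma nn_integral_subenv:
  assumes "f \<in> borel_measurable (env p)"
  shows "(\<integral>\<^sup>+\<xi>. f (subenv v \<xi>) \<partial>env p) = (\<integral>\<^sup>+\<xi>. f \<xi> \<partial>env p)"
  using nn_integral_distr[OF measurable_subenv[of v p], of f] assms by (simp add: distr_subenv)

lemma AE_subenv:
  assumes "AE \<xi> in env p. Q \<xi>"
  shows "AE \<xi> in env p. Q (subenv v \<xi>)"
  by (rule AE_distrD[OF measurable_subenv]) (unfold distr_subenv, rule assms)

lemma nn_integral_env_coord:
  fixes f :: "nat \<Rightarrow> ennreal"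
  shows "(\<integral>\<^sup>+\<xi>. f (\<xi> v) \<partial>env p) = (\<integral>\<^sup>+k. f k \<partial>measure_pmf p)"
  using nn_integral_distr[of "\<lambda>\<xi>. \<xi> v" "env p" "measure_pmf p" f]
  by (simp add: distr_env_coord)

lemma
  fixes f :: "nat \<Rightarrow> real"
  shows integral_env_coord: "(\<integral>\<xi>. f (\<xi> v) \<partial>env p) = (\<integral>k. f k \<partial>measure_pmf p)"
    and integrable_env_coord: "integrable (env p) (\<lambda>\<xi>. f (\<xi> v)) \<longleftrightarrow> integrable (measure_pmf p) f"
  using integral_distr[of "\<lambda>\<xi>. \<xi> v" "env p" "measure_pmf p" f]
    integrable_distr_eq[of "\<lambda>\<xi>. \<xi> v" "env p" "measure_pmf p" f]
  by (simp_all add: distr_env_coord)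

lemma measurable_generation_env [measurable]:
  "(\<lambda>\<xi>. generation n (tree_of \<xi>)) \<in> env p \<rightarrow>\<^sub>M count_space {A. finite A}"
  by (rule measurable_compose[OF measurable_tree_of measurable_generation])

lemma measurable_gen_size_env [measurable]:
  "(\<lambda>\<xi>. gen_size n (tree_of \<xi>)) \<in> env p \<rightarrow>\<^sub>M count_space UNIV"
  by (rule measurable_compose[OF measurable_tree_of measurable_gen_size])

lemma generation_eq_event [measurable]: "Measurable.pred (env p) (\<lambda>\<xi>. generation n (tree_of \<xi>) = A)"
proof (cases "finite A")
  case True
  then show ?thesis
    using measurable_compose[OF measurable_generation_env, of "\<lambda>B. B = A" "count_space UNIV"] by simp
next
  case False
  then have "generation n (tree_of \<xi>) \<noteq> A" for \<xi> using finite_generation by metis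
  then show ?thesis by simp
qed

section \<open>The branching property and moment bounds\<close>

text \<open>Generation \<open>n\<close> is decided by words shorter than \<open>n\<close>, while
  \<open>h A\<close> reads only words of length at least \<open>n\<close>. The environment inside
  \<open>h\<close> may therefore be replaced by an independent copy.\<close>

lemma nn_integral_generation:
  fixes h :: "nat list set \<Rightarrow> (nat list \<Rightarrow> nat) \<Rightarrow> ennreal"
  assumes meas: "\<And>A. finite A \<Longrightarrow> A \<subseteq> {v. length v = n} \<Longrightarrow> h A \<in> borel_measurable (env p)"
    and dep: "\<And>A. finite A \<Longrightarrow> A \<subseteq> {v. length v = n} \<Longrightarrow> depends_on {u. n \<le> length u} (h A)"
  shows "(\<integral>\<^sup>+\<xi>. h (generation n (tree_of \<xi>)) \<xi> \<partial>env p) =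
    (\<integral>\<^sup>+\<xi>. (\<integral>\<^sup>+\<zeta>. h (generation n (tree_of \<xi>)) \<zeta> \<partial>env p) \<partial>env p)"
proof -
  define C where "C = {A :: nat list set. finite A \<and> A \<subseteq> {v. length v = n}}"
  have "countable {A :: nat list set. finite A}" by (rule countable_Collect_finite)
  then have cC: "countable C" by (rule countable_subset[rotated]) (auto simp: C_def)
  let ?G = "\<lambda>\<xi>. generation n (tree_of \<xi>)"
  let ?I = "\<lambda>A \<xi>. indicator {\<xi>. ?G \<xi> = A} \<xi> :: ennreal"
  have GC: "?G \<xi> \<in> C" for \<xi>
    using finite_generation[of n "tree_of \<xi>"] by (auto simp: C_def generation_def)
  \<comment> \<open>Evaluation at the random set becomes a sum over its countably many possible
    values in which one term survives; this form lets sum and integral be exchanged.\<close>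
  have sel: "f (?G \<xi>) = (\<integral>\<^sup>+A. ?I A \<xi> * f A \<partial>count_space C)" for f :: "nat list set \<Rightarrow> ennreal" and \<xi>
  proof -
    have "(\<integral>\<^sup>+A. ?I A \<xi> * f A \<partial>count_space C) = (\<integral>\<^sup>+A. f (?G \<xi>) * indicator {?G \<xi>} A \<partial>count_space C)"
      by (intro nn_integral_cong) (auto split: split_indicator)
    then show ?thesis using GC[of \<xi>] by (simp add: nn_integral_cmult_indicator)
  qed
  have I: "?I A \<in> borel_measurable (env p)" for A
    by measurable
  have I_dep: "depends_on {u. length u < n} (?I A)" for A
    using depends_on_generation[of n] by (auto simp: depends_on_def indicator_def)
  have "(\<integral>\<^sup>+\<xi>. h (?G \<xi>) \<xi> \<partial>env p) = (\<integral>\<^sup>+\<xi>. (\<integral>\<^sup>+A. ?I A \<xi> * h A \<xi> \<partial>count_space C) \<partial>env p)"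
    by (subst sel[of "\<lambda>A. h A _"]) simp
  also have "\<dots> = (\<integral>\<^sup>+A. (\<integral>\<^sup>+\<xi>. ?I A \<xi> * h A \<xi> \<partial>env p) \<partial>count_space C)"
    using meas I by (intro nn_integral_count_space_nn_integral cC borel_measurable_times_ennreal)
      (auto simp: C_def)
  \<comment> \<open>For a fixed \<open>A\<close> the indicator and \<open>h A\<close> read disjoint
    coordinates, so the integral factors.\<close>
  also have "\<dots> = (\<integral>\<^sup>+A. (\<integral>\<^sup>+\<xi>. ?I A \<xi> \<partial>env p) * (\<integral>\<^sup>+\<zeta>. h A \<zeta> \<partial>env p) \<partial>count_space C)"
    using meas dep I I_dep
    by (intro nn_integral_cong nn_integral_PiM_mult_depends_on prob_space_measure_pmf)
      (auto simp: C_def)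
  also have "\<dots> = (\<integral>\<^sup>+A. (\<integral>\<^sup>+\<xi>. ?I A \<xi> * (\<integral>\<^sup>+\<zeta>. h A \<zeta> \<partial>env p) \<partial>env p) \<partial>count_space C)"
    using I by (simp add: nn_integral_multc)
  also have "\<dots> = (\<integral>\<^sup>+\<xi>. (\<integral>\<^sup>+A. ?I A \<xi> * (\<integral>\<^sup>+\<zeta>. h A \<zeta> \<partial>env p) \<partial>count_space C) \<partial>env p)"
    using I by (intro nn_integral_count_space_nn_integral[symmetric] cC) auto
  also have "\<dots> = (\<integral>\<^sup>+\<xi>. (\<integral>\<^sup>+\<zeta>. h (?G \<xi>) \<zeta> \<partial>env p) \<partial>env p)"
    by (subst sel[of "\<lambda>A. \<integral>\<^sup>+\<zeta>. h A \<zeta> \<partial>env p"]) simp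
  finally show ?thesis .
qed

text \<open>Independence and zero means kill the mixed terms of the expanded square.\<close>

lemma (in prob_space) expectation_power2_sum_indep:
  fixes X :: "'i \<Rightarrow> 'a \<Rightarrow> real"
  assumes A: "finite A" and ind: "indep_vars (\<lambda>_. borel) X A"
    and int: "\<And>i. i \<in> A \<Longrightarrow> integrable M (X i)"
    and zero: "\<And>i. i \<in> A \<Longrightarrow> expectation (X i) = 0"
    and sq: "\<And>i. i \<in> A \<Longrightarrow> integrable M (\<lambda>\<omega>. (X i \<omega>)\<^sup>2)"
  shows "integrable M (\<lambda>\<omega>. (\<Sum>i\<in>A. X i \<omega>)\<^sup>2)"
    and "expectation (\<lambda>\<omega>. (\<Sum>i\<in>A. X i \<omega>)\<^sup>2) = (\<Sum>i\<in>A. expectation (\<lambda>\<omega>. (X i \<omega>)\<^sup>2))"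
proof -
  have off: "integrable M (\<lambda>\<omega>. X i \<omega> * X j \<omega>) \<and> expectation (\<lambda>\<omega>. X i \<omega> * X j \<omega>) = 0"
    if "i \<in> A" "j \<in> A" "i \<noteq> j" for i j
  proof -
    have ind2: "indep_vars (\<lambda>_. borel) X {i, j}"
      using ind by (rule indep_vars_subset) (use that in auto)
    have "integrable M (\<lambda>\<omega>. \<Prod>k\<in>{i, j}. X k \<omega>)"
      by (rule indep_vars_integrable[OF _ ind2]) (use int that in auto)
    moreover have "expectation (\<lambda>\<omega>. \<Prod>k\<in>{i, j}. X k \<omega>) = (\<Prod>k\<in>{i, j}. expectation (X k))"
      by (rule indep_vars_lebesgue_integral[OF _ ind2]) (use int that in auto)
    ultimately show ?thesis using that zero by simp
  qed
  have prod_int: "integrable M (\<lambda>\<omega>. X i \<omega> * X j \<omega>)" if "i \<in> A" "j \<in> A" for i j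
    using off[of i j] sq[of i] that by (cases "i = j") (auto simp: power2_eq_square)
  have eq: "(\<Sum>i\<in>A. X i \<omega>)\<^sup>2 = (\<Sum>i\<in>A. \<Sum>j\<in>A. X i \<omega> * X j \<omega>)" for \<omega>
    by (simp add: power2_eq_square sum_product)
  show "integrable M (\<lambda>\<omega>. (\<Sum>i\<in>A. X i \<omega>)\<^sup>2)"
    unfolding eq using prod_int by auto
  have "expectation (\<lambda>\<omega>. (\<Sum>i\<in>A. X i \<omega>)\<^sup>2) = (\<Sum>i\<in>A. \<Sum>j\<in>A. expectation (\<lambda>\<omega>. X i \<omega> * X j \<omega>))"
    unfolding eq using prod_int by (simp add: Bochner_Integration.integral_sum)
  also have "\<dots> = (\<Sum>i\<in>A. \<Sum>j\<in>A. if i = j then expectation (\<lambda>\<omega>. (X i \<omega>)\<^sup>2) else 0)"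
    using off by (intro sum.cong) (auto simp: power2_eq_square)
  also have "\<dots> = (\<Sum>i\<in>A. expectation (\<lambda>\<omega>. (X i \<omega>)\<^sup>2))"
    using A by simp
  finally show "expectation (\<lambda>\<omega>. (\<Sum>i\<in>A. X i \<omega>)\<^sup>2) = (\<Sum>i\<in>A. expectation (\<lambda>\<omega>. (X i \<omega>)\<^sup>2))" .
qed

text \<open>Offspring numbers are split at the level \<open>c\<close>. The bounded part has variance
  at most \<open>c * a\<close>, and the large part contributes at most \<open>2 * t\<close> per
  summand. The scale \<open>s\<close> is free. The bound is affine in \<open>card A\<close>, so that
  later only the mean of the generation size enters.\<close>

lemma nn_integral_abs_sum_centered_le:
  fixes c s :: real
  assumes A: "finite A" and int: "integrable (measure_pmf p) real" and c: "0 \<le> c" and s: "0 < s"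
  defines "a \<equiv> measure_pmf.expectation p real"
    and "t \<equiv> measure_pmf.expectation p (\<lambda>k. if c < real k then real k else 0)"
  shows "(\<integral>\<^sup>+\<xi>. ennreal \<bar>\<Sum>v\<in>A. real (\<xi> v) - a\<bar> \<partial>env p)
    \<le> ennreal ((s + real (card A) * (c * a) / s) / 2 + 2 * real (card A) * t)"
proof -
  interpret E: prob_space "env p" by (rule prob_space_env)
  have E1: "E.prob UNIV = 1" using E.prob_space by simp
  define f where "f k = (if real k \<le> c then real k else 0)" for k :: nat
  define g where "g k = (if c < real k then real k else 0)" for k :: nat
  define m where "m = measure_pmf.expectation p f"
  have f_int: "integrable (measure_pmf p) f" and g_int: "integrable (measure_pmf p) g"
    by (rule Bochner_Integration.integrable_bound[OF int]; simp add: f_def g_def)+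
  have fg: "real k = f k + g k" for k by (simp add: f_def g_def)
  have "t = measure_pmf.expectation p g" by (simp add: t_def g_def[abs_def])
  moreover have "a = measure_pmf.expectation p (\<lambda>k. f k + g k)"
    unfolding a_def by (simp add: fg[symmetric])
  ultimately have a: "a = m + t" using f_int g_int by (simp add: m_def)
  have t0: "0 \<le> t" unfolding t_def by (intro integral_nonneg_AE) auto
  define X where "X v \<xi> = f (\<xi> v) - m" for v :: "nat list" and \<xi> :: "nat list \<Rightarrow> nat"
  have X_bd: "\<bar>X v \<xi>\<bar> \<le> c + \<bar>m\<bar>" for v \<xi>
    using c by (auto simp: X_def f_def)
  have X_meas[measurable]: "X v \<in> borel_measurable (env p)" for v
    unfolding X_def[abs_def] by measurable
  have ind: "E.indep_vars (\<lambda>_. borel) X A"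
    by (rule indep_vars_PiM_depends_on[where K = "\<lambda>v. {v}"])
      (auto simp: prob_space_measure_pmf X_meas depends_on_def X_def disjoint_family_on_def)
  have X_int: "integrable (env p) (X v)" for v
    by (rule E.integrable_const_bound[where B = "c + \<bar>m\<bar>"]) (use X_bd in auto)
  have X_sq: "integrable (env p) (\<lambda>\<xi>. (X v \<xi>)\<^sup>2)" for v
    by (rule E.integrable_const_bound[where B = "(c + \<bar>m\<bar>)\<^sup>2"])
      (use X_bd c in \<open>auto intro!: AE_I2 simp: abs_le_square_iff[symmetric]\<close>)
  have X_zero: "E.expectation (X v) = 0" for v
    unfolding X_def[abs_def]
    by (subst Bochner_Integration.integral_diff)
      (simp_all add: integral_env_coord integrable_env_coord f_int m_def E1)
  have f_sq_int: "integrable (measure_pmf p) (\<lambda>k. (f k)\<^sup>2)"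
    by (rule measure_pmf.integrable_const_bound[where B = "c\<^sup>2"])
      (use c in \<open>auto intro!: AE_I2 simp: f_def power_mono\<close>)
  have "E.expectation (\<lambda>\<xi>. (X v \<xi>)\<^sup>2) \<le> c * a" for v
  proof -
    have "E.expectation (\<lambda>\<xi>. (X v \<xi>)\<^sup>2) = measure_pmf.expectation p (\<lambda>k. (f k - m)\<^sup>2)"
      using integral_env_coord[of p "\<lambda>k. (f k - m)\<^sup>2" v] by (simp add: X_def)
    also have "\<dots> = measure_pmf.expectation p (\<lambda>k. (f k)\<^sup>2) - m\<^sup>2"
      using measure_pmf.variance_eq[OF f_int f_sq_int] by (simp add: m_def)
    also have "\<dots> \<le> measure_pmf.expectation p (\<lambda>k. (f k)\<^sup>2)" by simp
    \<comment> \<open>Where \<open>f\<close> is nonzero, \<open>f k = real k\<close> is at most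
      \<open>c\<close>, so its square is at most \<open>c * real k\<close>.\<close>
    also have "\<dots> \<le> measure_pmf.expectation p (\<lambda>k. c * real k)"
      by (rule integral_mono[OF f_sq_int]) (use int c in \<open>auto simp: f_def power2_eq_square mult_right_mono\<close>)
    also have "\<dots> = c * a" by (simp add: a_def)
    finally show ?thesis .
  qed
  then have sq_le: "E.expectation (\<lambda>\<xi>. (\<Sum>v\<in>A. X v \<xi>)\<^sup>2) \<le> real (card A) * (c * a)"
    using E.expectation_power2_sum_indep(2)[OF A ind X_int X_zero X_sq]
      sum_bounded_above[of A "\<lambda>v. E.expectation (\<lambda>\<xi>. (X v \<xi>)\<^sup>2)" "c * a"] by simp
  have sq_int: "integrable (env p) (\<lambda>\<xi>. (\<Sum>v\<in>A. X v \<xi>)\<^sup>2)"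
    using E.expectation_power2_sum_indep(1)[OF A ind X_int X_zero X_sq] .
  define R where "R \<xi> = (s + (\<Sum>v\<in>A. X v \<xi>)\<^sup>2 / s) / 2 + (\<Sum>v\<in>A. g (\<xi> v) + t)" for \<xi>
  have g_int': "integrable (env p) (\<lambda>\<xi>. g (\<xi> v))" for v
    by (simp add: integrable_env_coord g_int)
  have R_int: "integrable (env p) R"
    unfolding R_def[abs_def] using sq_int g_int' by auto
  have R_ge: "\<bar>\<Sum>v\<in>A. real (\<xi> v) - a\<bar> \<le> R \<xi>" for \<xi>
  proof -
    let ?S = "\<Sum>v\<in>A. X v \<xi>"
    have "(\<Sum>v\<in>A. real (\<xi> v) - a) = ?S + (\<Sum>v\<in>A. g (\<xi> v) - t)"
      by (simp add: sum.distrib[symmetric] X_def fg a algebra_simps)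
    \<comment> \<open>Both \<open>g\<close> and \<open>t\<close> are nonnegative, so the modulus of
      the difference is at most the sum; taking means yields the factor 2.\<close>
    moreover have "\<bar>\<Sum>v\<in>A. g (\<xi> v) - t\<bar> \<le> (\<Sum>v\<in>A. g (\<xi> v) + t)"
      using t0 by (intro order_trans[OF sum_abs] sum_mono) (auto simp: g_def)
    \<comment> \<open>The arithmetic-geometric mean inequality takes the place of Cauchy-Schwarz, so
      that no square root of \<open>card A\<close> appears.\<close>
    moreover have "\<bar>?S\<bar> \<le> (s + ?S\<^sup>2 / s) / 2"
    proof -
      have "0 \<le> (\<bar>?S\<bar> - s)\<^sup>2" by simp
      then have "2 * s * \<bar>?S\<bar> \<le> s * s + ?S\<^sup>2"
        by (simp add: power2_diff) (simp add: power2_eq_square algebra_simps)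
      then show ?thesis using s by (simp add: field_simps)
    qed
    ultimately show ?thesis unfolding R_def by linarith
  qed
  have "(\<integral>\<^sup>+\<xi>. ennreal \<bar>\<Sum>v\<in>A. real (\<xi> v) - a\<bar> \<partial>env p) \<le> (\<integral>\<^sup>+\<xi>. ennreal (R \<xi>) \<partial>env p)"
    by (intro nn_integral_mono ennreal_leI R_ge)
  also have "\<dots> = ennreal (E.expectation R)"
    using R_ge by (intro nn_integral_eq_integral R_int AE_I2) (meson abs_ge_zero order_trans)
  also have "E.expectation R
      = (s + E.expectation (\<lambda>\<xi>. (\<Sum>v\<in>A. X v \<xi>)\<^sup>2) / s) / 2 + 2 * real (card A) * t"
  proof -
    have "E.expectation (\<lambda>\<xi>. g (\<xi> v)) = t" for v
      using integral_env_coord[of p g v] by (simp add: t_def g_def[abs_def])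
    then show ?thesis
      unfolding R_def[abs_def] using sq_int g_int'
      by (simp add: Bochner_Integration.integral_sum E1)
  qed
  also have "ennreal \<dots> \<le> ennreal ((s + real (card A) * (c * a) / s) / 2 + 2 * real (card A) * t)"
    using sq_le s by (intro ennreal_leI add_mono divide_right_mono) auto
  finally show ?thesis .
qed

subsection \<open>Convergence of the normalised generation sizes\<close>

lemma convergent_if_summable_diff:
  fixes f :: "nat \<Rightarrow> real"
  assumes "summable (\<lambda>n. \<bar>f (Suc n) - f n\<bar>)"
  shows "convergent f"
proof -
  have "summable (\<lambda>n. f (Suc n) - f n)"
    using assms by (rule summable_rabs_cancel)
  then have "(\<lambda>n. \<Sum>k<n. f (Suc k) - f k) \<longlonglongrightarrow> (\<Sum>n. f (Suc n) - f n)"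
    by (rule summable_LIMSEQ)
  then have "(\<lambda>n. f n - f 0 + f 0) \<longlonglongrightarrow> (\<Sum>n. f (Suc n) - f n) + f 0"
    unfolding sum_lessThan_telescope by (intro tendsto_intros)
  then show ?thesis by (auto simp: convergent_def)
qed

section \<open>Consequences of the assumptions on the offspring law\<close>

locale nlogn_offspring =
  fixes p :: "nat pmf"
  assumes nondeg: "\<forall>k. p \<noteq> return_pmf k"
    and no_death: "pmf p 0 = 0"
    and nlogn: "integrable (measure_pmf p) (\<lambda>n. real n * ln (real n))"
begin

abbreviation a :: real where "a \<equiv> offspring_mean p"
abbreviation \<mu> :: nat where "\<mu> \<equiv> min_offspring p"
abbreviation G :: "nat \<Rightarrow> (nat list \<Rightarrow> nat) \<Rightarrow> nat list set" where "G n \<xi> \<equiv> generation n (tree_of \<xi>)"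
abbreviation Z :: "nat \<Rightarrow> (nat list \<Rightarrow> nat) \<Rightarrow> nat" where "Z n \<xi> \<equiv> gen_size n (tree_of \<xi>)"
abbreviation W :: "(nat list \<Rightarrow> nat) \<Rightarrow> real" where "W \<xi> \<equiv> martingale_limit p (tree_of \<xi>)"

sublocale E: prob_space "env p" by (rule prob_space_env)

lemma min_offspring_le: "k \<in> set_pmf p \<Longrightarrow> \<mu> \<le> k"
  unfolding min_offspring_def by (rule Least_le) (simp add: pmf_positive)

lemma pmf_min_offspring: "0 < pmf p \<mu>"
proof -
  obtain k where "k \<in> set_pmf p" using set_pmf_not_empty[of p] by auto
  then show ?thesis
    unfolding min_offspring_def by (intro LeastI[of "\<lambda>n. 0 < pmf p n" k]) (simp add: pmf_positive)
qed

lemma min_offspring_ge_1: "1 \<le> \<mu>"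
  using pmf_min_offspring no_death by (cases \<mu>) auto

text \<open>Otherwise \<open>p\<close> would be concentrated at \<open>\<mu>\<close>.\<close>

lemma ex_offspring_gt: "\<exists>k\<in>set_pmf p. \<mu> < k"
proof (rule ccontr)
  assume "\<not> ?thesis"
  then have "set_pmf p \<subseteq> {\<mu>}" using min_offspring_le by (auto simp: not_less intro: antisym)
  then show False using nondeg by (simp add: set_pmf_subset_singleton)
qed

lemma integrable_offspring: "integrable (measure_pmf p) real"
proof (rule Bochner_Integration.integrable_bound)
  show "integrable (measure_pmf p) (\<lambda>n. 3 + real n * ln (real n))"
    using nlogn by simp
  \<comment> \<open>Above 3 the logarithm is at least 1, since \<open>exp 1 \<le> 3\<close>; the
    constant 3 covers the remaining values.\<close>
  have "real n \<le> 3 + real n * ln (real n)" for n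
  proof (cases "n \<le> 3")
    case True
    have "0 \<le> real n * ln (real n)" by (cases "n = 0") auto
    then show ?thesis using True by linarith
  next
    case False
    then have "exp 1 \<le> real n" using exp_le by linarith
    then have "1 \<le> ln (real n)" using False by (subst ln_ge_iff) auto
    then have "real n * 1 \<le> real n * ln (real n)" by (intro mult_left_mono) auto
    then show ?thesis by linarith
  qed
  then show "AE n in measure_pmf p. norm (real n) \<le> norm (3 + real n * ln (real n))"
    by (intro AE_I2) (metis abs_ge_self norm_of_nat order_trans real_norm_def)
qed simp

text \<open>The excess over \<open>\<mu>\<close> is nonnegative and not almost surely zero, hence
  has positive mean.\<close>

lemma min_offspring_less_mean: "real \<mu> < a"
proof -
  have int: "integrable (measure_pmf p) (\<lambda>n. real n - real \<mu>)"
    using integrable_offspring by simp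
  have nonneg: "AE n in measure_pmf p. 0 \<le> real n - real \<mu>"
    using min_offspring_le by (simp add: AE_measure_pmf_iff)
  have "\<not> (AE n in measure_pmf p. real n - real \<mu> = 0)"
    using ex_offspring_gt by (force simp: AE_measure_pmf_iff)
  then have "measure_pmf.expectation p (\<lambda>n. real n - real \<mu>) \<noteq> 0"
    using integral_nonneg_eq_0_iff_AE[OF int nonneg] by blast
  moreover have "0 \<le> measure_pmf.expectation p (\<lambda>n. real n - real \<mu>)"
    using nonneg by (rule integral_nonneg_AE)
  ultimately show ?thesis
    using integrable_offspring by (simp add: offspring_mean_def)
qed

lemma mean_gt_1: "1 < a"
  using min_offspring_less_mean min_offspring_ge_1 by linarith

section \<open>Expected generation sizes and summable increments\<close>

text \<open>By the branching property, each member of generation \<open>n\<close> has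
  \<open>a\<close> children on average, whatever that generation is.\<close>

lemma nn_integral_gen_size: "(\<integral>\<^sup>+\<xi>. ennreal (real (Z n \<xi>)) \<partial>env p) = ennreal (a ^ n)"
proof (induction n)
  case 0
  then show ?case using E.emeasure_space_1 by (simp add: gen_size_0)
next
  case (Suc n)
  define h where "h A \<xi> = ennreal (\<Sum>v\<in>A. real (\<xi> v))" for A :: "nat list set" and \<xi> :: "nat list \<Rightarrow> nat"
  have h: "(\<integral>\<^sup>+\<zeta>. h A \<zeta> \<partial>env p) = ennreal (real (card A)) * ennreal a" if "finite A" for A
  proof -
    have "(\<integral>\<^sup>+\<zeta>. h A \<zeta> \<partial>env p) = (\<integral>\<^sup>+\<zeta>. (\<Sum>v\<in>A. ennreal (real (\<zeta> v))) \<partial>env p)"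
      by (simp add: h_def sum_ennreal)
    also have "\<dots> = (\<Sum>v\<in>A. \<integral>\<^sup>+\<zeta>. ennreal (real (\<zeta> v)) \<partial>env p)"
      by (rule nn_integral_sum) measurable
    also have "\<dots> = (\<Sum>v\<in>A. ennreal a)"
      unfolding nn_integral_env_coord[where f = "\<lambda>k. ennreal (real k)"]
      by (subst nn_integral_eq_integral) (simp_all add: integrable_offspring offspring_mean_def)
    finally show ?thesis by (simp add: ennreal_of_nat_eq_real_of_nat)
  qed
  have "(\<integral>\<^sup>+\<xi>. ennreal (real (Z (Suc n) \<xi>)) \<partial>env p) = (\<integral>\<^sup>+\<xi>. h (G n \<xi>) \<xi> \<partial>env p)"
    by (simp add: gen_size_Suc h_def)
  also have "\<dots> = (\<integral>\<^sup>+\<xi>. (\<integral>\<^sup>+\<zeta>. h (G n \<xi>) \<zeta> \<partial>env p) \<partial>env p)"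
  proof (rule nn_integral_generation)
    fix A :: "nat list set" assume A: "A \<subseteq> {v. length v = n}"
    show "h A \<in> borel_measurable (env p)" unfolding h_def[abs_def] by measurable
    show "depends_on {u. n \<le> length u} (h A)"
      unfolding depends_on_def h_def
      using A by (intro allI impI arg_cong[where f = ennreal] sum.cong) auto
  qed
  also have "\<dots> = (\<integral>\<^sup>+\<xi>. ennreal (real (Z n \<xi>)) * ennreal a \<partial>env p)"
    by (simp add: h finite_generation gen_size_def)
  also have "\<dots> = (\<integral>\<^sup>+\<xi>. ennreal (real (Z n \<xi>)) \<partial>env p) * ennreal a"
    by (rule nn_integral_multc) measurable
  finally show ?case
    using Suc mean_gt_1 by (simp add: ennreal_mult[symmetric] mult.commute)
qed

lemma nn_integral_affine_gen_size:
  assumes "0 \<le> \<alpha>" "0 \<le> \<beta>"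
  shows "(\<integral>\<^sup>+\<xi>. ennreal (\<alpha> + \<beta> * real (Z n \<xi>)) \<partial>env p) = ennreal (\<alpha> + \<beta> * a ^ n)"
proof -
  have "(\<integral>\<^sup>+\<xi>. ennreal (\<alpha> + \<beta> * real (Z n \<xi>)) \<partial>env p)
      = (\<integral>\<^sup>+\<xi>. ennreal \<alpha> + ennreal \<beta> * ennreal (real (Z n \<xi>)) \<partial>env p)"
    using assms by (simp add: ennreal_mult)
  also have "\<dots> = ennreal \<alpha> + ennreal \<beta> * ennreal (a ^ n)"
    using E.emeasure_space_1
    by (subst nn_integral_add) (simp_all add: nn_integral_cmult nn_integral_gen_size)
  finally show ?thesis using assms mean_gt_1 by (simp add: ennreal_mult)
qed

text \<open>With the fourth root of \<open>a\<close> all rates are natural powers: the truncation level for generation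
  \<open>n\<close> is \<open>r ^ (2 * n)\<close>.\<close>

definition r :: real where "r = root 4 a"

lemma r_gt_1: "1 < r" and r_pow_4: "r ^ 4 = a"
  using mean_gt_1 by (simp_all add: r_def)

definition tail :: "nat \<Rightarrow> real" where
  "tail n = measure_pmf.expectation p (\<lambda>k. if r ^ (2 * n) < real k then real k else 0)"

lemma tail_nonneg: "0 \<le> tail n"
  unfolding tail_def by (intro integral_nonneg_AE) auto

text \<open>After exchanging sum and expectation it suffices to count, for a fixed offspring number
  \<open>k\<close>, the levels \<open>r ^ (2 * n)\<close> below \<open>k\<close>. Their number is
  logarithmic in \<open>k\<close>, so the total is controlled by the means of \<open>N\<close> and
  \<open>N log N\<close>.\<close>

lemma summable_tail: "summable tail"
proof (rule bounded_imp_summable[OF tail_nonneg])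
  fix m
  let ?f = "\<lambda>n k. if r ^ (2 * n) < real k then real k else 0"
  have int: "integrable (measure_pmf p) (?f n)" for n
    by (rule Bochner_Integration.integrable_bound[OF integrable_offspring]) auto
  have lr: "0 < ln r" using r_gt_1 by simp
  have pt: "(\<Sum>n\<le>m. ?f n k) \<le> real k + real k * ln (real k) / (2 * ln r)" for k :: nat
  proof (cases "k = 0")
    case False
    \<comment> \<open>\<open>L\<close> is the real exponent for which \<open>r\<close> to the power
      \<open>2 * L\<close> equals \<open>k\<close>, so the levels below \<open>k\<close> are those
      with \<open>n < L\<close>; rounding up costs at most one.\<close>
    define L where "L = ln (real k) / (2 * ln r)"
    have L0: "0 \<le> L" using False lr by (simp add: L_def)
    have "{n. n \<le> m \<and> r ^ (2 * n) < real k} \<subseteq> {..<nat \<lceil>L\<rceil>}"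
    proof (intro subsetI, elim CollectE conjE)
      fix n assume "r ^ (2 * n) < real k"
      then have "ln (r ^ (2 * n)) < ln (real k)" using r_gt_1 False by (subst ln_less_cancel_iff) auto
      then have "real n < L" using r_gt_1 lr by (simp add: L_def ln_realpow field_simps)
      then show "n \<in> {..<nat \<lceil>L\<rceil>}" by (auto simp: zless_nat_eq_int_zless less_ceiling_iff)
    qed
    then have "card {n. n \<le> m \<and> r ^ (2 * n) < real k} \<le> nat \<lceil>L\<rceil>"
      using card_mono[of "{..<nat \<lceil>L\<rceil>}"] by simp
    moreover have "real (nat \<lceil>L\<rceil>) \<le> L + 1" using L0 by linarith
    ultimately have "real (card {n. n \<le> m \<and> r ^ (2 * n) < real k}) \<le> L + 1" by linarith
    moreover have "(\<Sum>n\<le>m. ?f n k) = real (card {n. n \<le> m \<and> r ^ (2 * n) < real k}) * real k"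
    proof -
      have "(\<Sum>n\<le>m. ?f n k) = (\<Sum>n\<in>{n\<in>{..m}. r ^ (2 * n) < real k}. real k)"
        by (rule sum.inter_filter[symmetric]) simp
      then show ?thesis by simp
    qed
    ultimately have "(\<Sum>n\<le>m. ?f n k) \<le> (L + 1) * real k" by (simp add: mult_right_mono)
    then show ?thesis by (simp add: L_def algebra_simps)
  qed simp
  have "(\<Sum>n\<le>m. tail n) = measure_pmf.expectation p (\<lambda>k. \<Sum>n\<le>m. ?f n k)"
    unfolding tail_def using int by (subst Bochner_Integration.integral_sum) auto
  also have "\<dots> \<le> measure_pmf.expectation p (\<lambda>k. real k + real k * ln (real k) / (2 * ln r))"
    by (intro integral_mono pt) (use int integrable_offspring nlogn in auto)
  finally show "(\<Sum>n\<le>m. tail n) \<le> \<dots>" .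
qed

definition D :: "nat \<Rightarrow> (nat list \<Rightarrow> nat) \<Rightarrow> real" where
  "D n \<xi> = \<bar>real (Z (Suc n) \<xi>) / a ^ Suc n - real (Z n \<xi>) / a ^ n\<bar>"

text \<open>An upper bound for the mean of \<open>D n\<close>: the geometric part comes from the
  truncated offspring numbers, the other part from what the truncation cuts off.\<close>

definition b :: "nat \<Rightarrow> real" where
  "b n = (1 + a) / (2 * a) * (1 / r) ^ n + 2 / a * tail n"

lemma summable_b: "summable b"
  unfolding b_def[abs_def] using r_gt_1 summable_tail
  by (intro summable_add summable_mult summable_geometric) auto

lemma b_nonneg: "0 \<le> b n"
  using mean_gt_1 r_gt_1 tail_nonneg by (simp add: b_def)

lemma measurable_D [measurable]: "D n \<in> borel_measurable (env p)"
  unfolding D_def[abs_def] by measurable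

lemma D_nonneg: "0 \<le> D n \<xi>"
  by (simp add: D_def)

text \<open>Given generation \<open>n\<close>, the increment is a multiple of a centred sum over
  that generation. Its mean is bounded by an affine function of \<open>Z n\<close>, which is then
  averaged.\<close>

lemma nn_integral_D_le: "(\<integral>\<^sup>+\<xi>. ennreal (D n \<xi>) \<partial>env p) \<le> ennreal (b n)"
proof -
  define h where "h A \<xi> = ennreal \<bar>\<Sum>v\<in>A. real (\<xi> v) - a\<bar>" for A :: "nat list set" and \<xi> :: "nat list \<Rightarrow> nat"
  \<comment> \<open>Since \<open>a ^ n = r ^ (4 * n)\<close>, the scale \<open>s\<close> sits midway
    between \<open>c\<close> and \<open>a ^ n\<close> in the exponent: both \<open>s / a ^ n\<close>
    and \<open>c / s\<close> equal \<open>(1 / r) ^ n\<close>.\<close>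
  define s where "s = r ^ (3 * n)"
  define c where "c = r ^ (2 * n)"
  have a0: "0 < a" using mean_gt_1 by simp
  have r0: "0 < r" using r_gt_1 by simp
  have s0: "0 < s" using r0 by (simp add: s_def)
  have alg: "i * ((s + z * (c * a) / s) / 2 + 2 * z * t) = i * (s / 2) + i * (c * a / (2 * s) + 2 * t) * z"
    for i z t :: real
    using s0 by (simp add: field_simps)
  have D: "D n \<xi> = inverse (a ^ Suc n) * \<bar>\<Sum>v\<in>G n \<xi>. real (\<xi> v) - a\<bar>" for \<xi>
  proof -
    have "(\<Sum>v\<in>G n \<xi>. real (\<xi> v) - a) = real (Z (Suc n) \<xi>) - real (Z n \<xi>) * a"
      unfolding gen_size_Suc by (simp add: gen_size_def sum_subtractf)
    then have "real (Z (Suc n) \<xi>) / a ^ Suc n - real (Z n \<xi>) / a ^ n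
        = inverse (a ^ Suc n) * (\<Sum>v\<in>G n \<xi>. real (\<xi> v) - a)"
      using a0 by (simp add: field_simps)
    then show ?thesis using a0 by (simp add: D_def abs_mult)
  qed
  have "(\<integral>\<^sup>+\<xi>. ennreal (D n \<xi>) \<partial>env p) = (\<integral>\<^sup>+\<xi>. ennreal (inverse (a ^ Suc n)) * h (G n \<xi>) \<xi> \<partial>env p)"
    unfolding D h_def using a0 by (intro nn_integral_cong ennreal_mult) auto
  also have "\<dots> = (\<integral>\<^sup>+\<xi>. (\<integral>\<^sup>+\<zeta>. ennreal (inverse (a ^ Suc n)) * h (G n \<xi>) \<zeta> \<partial>env p) \<partial>env p)"
  proof (rule nn_integral_generation)
    fix A :: "nat list set" assume A: "A \<subseteq> {v. length v = n}"
    show "(\<lambda>\<zeta>. ennreal (inverse (a ^ Suc n)) * h A \<zeta>) \<in> borel_measurable (env p)"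
      unfolding h_def[abs_def] by measurable
    show "depends_on {u. n \<le> length u} (\<lambda>\<zeta>. ennreal (inverse (a ^ Suc n)) * h A \<zeta>)"
      unfolding depends_on_def h_def
      using A by (intro allI impI arg_cong2[where f = "(*)"] arg_cong[where f = ennreal]
          arg_cong[where f = abs] sum.cong) auto
  qed
  also have "\<dots> \<le> (\<integral>\<^sup>+\<xi>. ennreal (inverse (a ^ Suc n) * (s / 2)
      + inverse (a ^ Suc n) * (c * a / (2 * s) + 2 * tail n) * real (Z n \<xi>)) \<partial>env p)"
  proof (intro nn_integral_mono)
    fix \<xi>
    have "(\<integral>\<^sup>+\<zeta>. ennreal (inverse (a ^ Suc n)) * h (G n \<xi>) \<zeta> \<partial>env p)
        = ennreal (inverse (a ^ Suc n)) * (\<integral>\<^sup>+\<zeta>. h (G n \<xi>) \<zeta> \<partial>env p)"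
      unfolding h_def by (intro nn_integral_cmult) measurable
    also have "\<dots> \<le> ennreal (inverse (a ^ Suc n)) *
        ennreal ((s + real (card (G n \<xi>)) * (c * a) / s) / 2 + 2 * real (card (G n \<xi>)) * tail n)"
      unfolding h_def tail_def offspring_mean_def c_def[symmetric]
      by (intro mult_left_mono nn_integral_abs_sum_centered_le)
        (use r0 in \<open>auto simp: finite_generation integrable_offspring s_def c_def\<close>)
    also have "\<dots> = ennreal (inverse (a ^ Suc n) *
        ((s + real (card (G n \<xi>)) * (c * a) / s) / 2 + 2 * real (card (G n \<xi>)) * tail n))"
      using a0 r0 tail_nonneg by (intro ennreal_mult[symmetric]) (auto simp: s_def c_def)
    also have "inverse (a ^ Suc n) *
        ((s + real (card (G n \<xi>)) * (c * a) / s) / 2 + 2 * real (card (G n \<xi>)) * tail n)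
       = inverse (a ^ Suc n) * (s / 2)
      + inverse (a ^ Suc n) * (c * a / (2 * s) + 2 * tail n) * real (Z n \<xi>)"
      unfolding gen_size_def by (rule alg)
    finally show "(\<integral>\<^sup>+\<zeta>. ennreal (inverse (a ^ Suc n)) * h (G n \<xi>) \<zeta> \<partial>env p) \<le> ennreal \<dots>" .
  qed
  also have "\<dots> = ennreal (inverse (a ^ Suc n) * (s / 2)
      + inverse (a ^ Suc n) * (c * a / (2 * s) + 2 * tail n) * a ^ n)"
    using a0 r0 tail_nonneg by (intro nn_integral_affine_gen_size) (auto simp: s_def c_def)
  also have "inverse (a ^ Suc n) * (s / 2)
      + inverse (a ^ Suc n) * (c * a / (2 * s) + 2 * tail n) * a ^ n = b n"
  proof -
    define q where "q = (1 / r) ^ n"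
    have qr: "q * r ^ n = 1" using r0 by (simp add: q_def power_one_over)
    have an: "a ^ n = r ^ n * s"
      by (simp add: r_pow_4[symmetric] s_def power_mult[symmetric] power_add[symmetric])
    have "s = r ^ n * c"
      by (simp add: s_def c_def power_add[symmetric])
    then have c: "c = q * s" using qr by (simp add: mult.assoc[symmetric])
    have "s = q * a ^ n" using qr by (simp add: an mult.assoc[symmetric])
    then have e1: "inverse (a ^ Suc n) * (s / 2) = q / (2 * a)"
      using a0 by (simp add: field_simps)
    have e2: "inverse (a ^ Suc n) * y * a ^ n = y / a" for y
      using a0 by (simp add: field_simps)
    have e3: "c * a / (2 * s) = a * q / 2"
      using s0 by (simp add: c)
    show ?thesis
      unfolding e1 e2 e3 b_def q_def[symmetric] using a0 by (simp add: field_simps)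
  qed
  finally show ?thesis .
qed

text \<open>The shift by \<open>k\<close> retains the remainder of the series, which is small for
  large \<open>k\<close> because \<open>b\<close> is summable.\<close>

lemma nn_integral_suminf_D_le:
  "(\<integral>\<^sup>+\<xi>. (\<Sum>n. ennreal (D (n + k) \<xi>)) \<partial>env p) \<le> ennreal (\<Sum>n. b (n + k))"
proof -
  have "(\<integral>\<^sup>+\<xi>. (\<Sum>n. ennreal (D (n + k) \<xi>)) \<partial>env p) = (\<Sum>n. \<integral>\<^sup>+\<xi>. ennreal (D (n + k) \<xi>) \<partial>env p)"
    by (rule nn_integral_suminf) measurable
  also have "\<dots> \<le> (\<Sum>n. ennreal (b (n + k)))"
    by (intro suminf_le nn_integral_D_le) auto
  also have "\<dots> = ennreal (\<Sum>n. b (n + k))"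
    using summable_b by (intro suminf_ennreal2 b_nonneg) (simp add: summable_iff_shift)
  finally show ?thesis .
qed

lemma AE_summable_D: "AE \<xi> in env p. summable (\<lambda>n. D n \<xi>)"
proof -
  have "(\<integral>\<^sup>+\<xi>. (\<Sum>n. ennreal (D n \<xi>)) \<partial>env p) \<noteq> \<infinity>"
    using nn_integral_suminf_D_le[of 0] by (auto simp: top_unique)
  then have "AE \<xi> in env p. (\<Sum>n. ennreal (D n \<xi>)) \<noteq> \<infinity>"
    by (intro nn_integral_PInf_AE) measurable
  then show ?thesis
    by eventually_elim (intro summable_suminf_not_top D_nonneg, simp)
qed

section \<open>The limit and its recursion over the subtrees\<close>

abbreviation convergent_env :: "(nat list \<Rightarrow> nat) \<Rightarrow> bool" where
  "convergent_env \<xi> \<equiv> convergent (\<lambda>n. real (Z n \<xi>) / a ^ n)"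

lemma AE_convergent_env: "AE \<xi> in env p. convergent_env \<xi>"
  using AE_summable_D
  by eventually_elim (intro convergent_if_summable_diff, simp add: D_def)

lemma LIMSEQ_W: "convergent_env \<xi> \<Longrightarrow> (\<lambda>n. real (Z n \<xi>) / a ^ n) \<longlonglongrightarrow> W \<xi>"
  by (simp add: martingale_limit_def convergent_LIMSEQ_iff)

lemma W_nonneg: "convergent_env \<xi> \<Longrightarrow> 0 \<le> W \<xi>"
  by (rule LIMSEQ_le_const[OF LIMSEQ_W]) (use mean_gt_1 in auto)

text \<open>Divide \<open>gen_size_add\<close> by \<open>a ^ (n + k)\<close> and let
  \<open>k\<close> tend to infinity in the finite sum over generation \<open>n\<close>.\<close>

lemma W_decomposition:
  assumes "\<And>v. convergent_env (subenv v \<xi>)"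
  shows "W \<xi> = (\<Sum>v\<in>G n \<xi>. W (subenv v \<xi>)) / a ^ n"
proof -
  have conv: "convergent_env \<xi>" using assms[of "[]"] by (simp add: subenv_def)
  have "(\<lambda>k. real (Z (k + n) \<xi>) / a ^ (k + n)) \<longlonglongrightarrow> W \<xi>"
    by (rule LIMSEQ_ignore_initial_segment[OF LIMSEQ_W[OF conv]])
  moreover have "real (Z (k + n) \<xi>) / a ^ (k + n)
      = (\<Sum>v\<in>G n \<xi>. real (Z k (subenv v \<xi>)) / a ^ k) / a ^ n" for k
    using gen_size_add[of n k \<xi>] by (simp add: add.commute power_add sum_divide_distrib)
  moreover have "(\<lambda>k. (\<Sum>v\<in>G n \<xi>. real (Z k (subenv v \<xi>)) / a ^ k) / a ^ n)
      \<longlonglongrightarrow> (\<Sum>v\<in>G n \<xi>. W (subenv v \<xi>)) / a ^ n"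
    using mean_gt_1 by (intro tendsto_intros LIMSEQ_W assms) auto
  ultimately show ?thesis by (simp add: LIMSEQ_unique)
qed

lemma measurable_W [measurable]: "W \<in> borel_measurable (env p)"
  by (rule measurable_compose[OF measurable_tree_of borel_measurable_martingale_limit])

lemma measurable_W_subenv [measurable]: "(\<lambda>\<xi>. W (subenv v \<xi>)) \<in> borel_measurable (env p)"
  by (rule measurable_compose[OF measurable_subenv measurable_W])

text \<open>If \<open>W\<close> vanished almost surely, \<open>Z k / a ^ k\<close> would be at most
  the sum of the increments from \<open>k\<close> on. Its mean is 1, whereas the mean of that sum is
  below 1 for large \<open>k\<close>.\<close>

lemma not_AE_W_eq_0: "\<not> (AE \<xi> in env p. W \<xi> = 0)"
proof
  assume zero: "AE \<xi> in env p. W \<xi> = 0"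
  have "(\<lambda>k. \<Sum>n. b (n + k)) \<longlonglongrightarrow> 0"
    using suminf_exist_split2[OF summable_b] by simp
  then have "\<forall>\<^sub>F k in sequentially. (\<Sum>n. b (n + k)) < 1"
    by (rule order_tendstoD(2)) simp
  then obtain k where k: "(\<Sum>n. b (n + k)) < 1"
    unfolding eventually_sequentially by blast
  have "AE \<xi> in env p. ennreal (real (Z k \<xi>) / a ^ k) \<le> (\<Sum>n. ennreal (D (n + k) \<xi>))"
    using zero AE_summable_D
  proof eventually_elim
    case (elim \<xi>)
    have sm: "summable (\<lambda>n. D (n + k) \<xi>)" using elim(2) by (rule summable_ignore_initial_segment)
    let ?f = "\<lambda>n. real (Z n \<xi>) / a ^ n"
    have "convergent ?f"
      using elim(2) by (intro convergent_if_summable_diff) (simp add: D_def)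
    from LIMSEQ_ignore_initial_segment[OF LIMSEQ_W[OF this], of k]
    have "(\<lambda>m. ?f (m + k)) \<longlonglongrightarrow> 0" using elim by simp
    then have "(\<lambda>m. ?f k - ?f (m + k)) \<longlonglongrightarrow> ?f k - 0" by (intro tendsto_intros)
    \<comment> \<open>Telescoping between \<open>k\<close> and \<open>m + k\<close> gives a bound
      uniform in \<open>m\<close>, which passes to the limit.\<close>
    moreover have "?f k - ?f (m + k) \<le> (\<Sum>n. D (n + k) \<xi>)" for m
    proof -
      have "?f k - ?f (m + k) = - (\<Sum>n<m. ?f (Suc n + k) - ?f (n + k))"
        by (subst sum_lessThan_telescope[of "\<lambda>n. ?f (n + k)"]) simp
      also have "\<dots> \<le> (\<Sum>n<m. D (n + k) \<xi>)"
        unfolding sum_negf[symmetric] by (intro sum_mono) (simp only: D_def add_Suc abs_ge_minus_self)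
      also have "\<dots> \<le> (\<Sum>n. D (n + k) \<xi>)"
        using sm by (intro sum_le_suminf) (auto simp: D_nonneg)
      finally show ?thesis .
    qed
    ultimately have "?f k - 0 \<le> (\<Sum>n. D (n + k) \<xi>)"
      by (intro LIMSEQ_le_const2) auto
    then show ?case
      using sm by (subst suminf_ennreal2) (auto simp: D_nonneg intro!: ennreal_leI)
  qed
  then have "(\<integral>\<^sup>+\<xi>. ennreal (real (Z k \<xi>) / a ^ k) \<partial>env p) \<le> (\<integral>\<^sup>+\<xi>. (\<Sum>n. ennreal (D (n + k) \<xi>)) \<partial>env p)"
    by (rule nn_integral_mono_AE)
  also have "\<dots> \<le> ennreal (\<Sum>n. b (n + k))" by (rule nn_integral_suminf_D_le)
  also have "\<dots> < 1" using k by (simp add: ennreal_less_one_iff)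
  finally have "(\<integral>\<^sup>+\<xi>. ennreal (real (Z k \<xi>) / a ^ k) \<partial>env p) < 1" .
  moreover have "(\<integral>\<^sup>+\<xi>. ennreal (real (Z k \<xi>) / a ^ k) \<partial>env p) = 1"
    using nn_integral_affine_gen_size[of 0 "1 / a ^ k" k] mean_gt_1 by simp
  ultimately show False by simp
qed

end

subsection \<open>Small values of the martingale limit\<close>

context nlogn_offspring
begin

text \<open>Subtrees at distinct words of equal length read disjoint sets of coordinates, and each
  has the original law.\<close>

lemma nn_integral_prod_subenv:
  fixes f :: "nat list \<Rightarrow> (nat list \<Rightarrow> nat) \<Rightarrow> ennreal"
  assumes A: "finite A" "A \<subseteq> {v. length v = n}"
    and f: "\<And>v. v \<in> A \<Longrightarrow> f v \<in> borel_measurable (env p)"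
  shows "(\<integral>\<^sup>+\<xi>. (\<Prod>v\<in>A. f v (subenv v \<xi>)) \<partial>env p) = (\<Prod>v\<in>A. \<integral>\<^sup>+\<xi>. f v \<xi> \<partial>env p)"
proof -
  have "(\<integral>\<^sup>+\<xi>. (\<Prod>v\<in>A. f v (subenv v \<xi>)) \<partial>env p) = (\<Prod>v\<in>A. \<integral>\<^sup>+\<xi>. f v (subenv v \<xi>) \<partial>env p)"
  proof (rule nn_integral_PiM_prod_depends_on[where K = "\<lambda>v. range ((@) v)"])
    show "depends_on (range ((@) v)) (\<lambda>\<xi>. f v (subenv v \<xi>))" for v
      by (rule depends_on_comp[OF depends_on_subenv])
    show "(\<lambda>\<xi>. f v (subenv v \<xi>)) \<in> borel_measurable (env p)" if "v \<in> A" for v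
      by (rule measurable_compose[OF measurable_subenv f[OF that]])
    show "disjoint_family_on (\<lambda>v. range ((@) v)) A"
      unfolding disjoint_family_on_def
    proof (intro ballI impI)
      fix v w assume "v \<in> A" "w \<in> A" "v \<noteq> w"
      then show "range ((@) v) \<inter> range ((@) w) = {}"
        using A(2) by (intro disjoint_ranges_append) auto
    qed
  qed (use A in \<open>auto simp: prob_space_measure_pmf\<close>)
  also have "\<dots> = (\<Prod>v\<in>A. \<integral>\<^sup>+\<xi>. f v \<xi> \<partial>env p)"
    using f by (intro prod.cong nn_integral_subenv) auto
  finally show ?thesis .
qed

text \<open>There are countably many words, so one almost sure event serves all subtrees at once;
  the pathwise comparisons below are made on it.\<close>

lemma AE_good:
  "AE \<xi> in env p. (\<forall>v. convergent_env (subenv v \<xi>)) \<and> (\<forall>v. \<xi> v \<in> set_pmf p)"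
proof -
  have "AE \<xi> in env p. \<forall>v. convergent_env (subenv v \<xi>)"
    using AE_subenv[OF AE_convergent_env] by (simp add: AE_all_countable)
  moreover have "AE \<xi> in env p. \<xi> v \<in> set_pmf p" for v
    by (rule AE_PiM_component) (auto simp: prob_space_measure_pmf AE_measure_pmf)
  then have "AE \<xi> in env p. \<forall>v. \<xi> v \<in> set_pmf p"
    by (simp add: AE_all_countable)
  ultimately show ?thesis by eventually_elim blast
qed

lemma W_less_iff:
  assumes "\<And>v. convergent_env (subenv v \<xi>)"
  shows "W \<xi> < \<epsilon> \<longleftrightarrow> (\<Sum>v\<in>G n \<xi>. W (subenv v \<xi>)) < a ^ n * \<epsilon>"
  using mean_gt_1 by (subst W_decomposition[OF assms, of n]) (simp add: pos_divide_less_eq mult.commute)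

lemma W_event [measurable]: "{\<xi>. W \<xi> < x} \<in> sets (env p)" "{\<xi>. W \<xi> = x} \<in> sets (env p)"
  using measurable_sets[OF measurable_W, of "{..<x}"] measurable_sets[OF measurable_W, of "{x}"]
  by (simp_all add: vimage_def)

text \<open>The probability \<open>q = P(W = 0)\<close> satisfies \<open>q \<le> E[q\<^sup>N]\<close>, so \<open>q\<close> is 0 or 1.\<close>

lemma AE_W_pos: "AE \<xi> in env p. 0 < W \<xi>"
proof -
  define q where "q = E.prob {\<xi>. W \<xi> = 0}"
  have q01: "0 \<le> q" "q \<le> 1" by (simp_all add: q_def)
  define B where "B = {\<xi>. W \<xi> = 0}"
  have B [measurable]: "B \<in> sets (env p)" unfolding B_def by measurable
  have em: "emeasure (env p) B = ennreal q" by (simp add: E.emeasure_eq_measure q_def B_def)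
  define h where "h A \<xi> = (\<Prod>v\<in>A. indicator B (subenv v \<xi>) :: ennreal)"
    for A :: "nat list set" and \<xi> :: "nat list \<Rightarrow> nat"
  have "AE \<xi> in env p. indicator B \<xi> \<le> h (G 1 \<xi>) \<xi>"
    using AE_good
  proof eventually_elim
    case (elim \<xi>)
    \<comment> \<open>A sum of nonnegative limits vanishes only if each of them does: a zero limit
      at the root is inherited by every child.\<close>
    have "W (subenv v \<xi>) = 0" if "W \<xi> = 0" "v \<in> G 1 \<xi>" for v
    proof -
      have "(\<Sum>v\<in>G 1 \<xi>. W (subenv v \<xi>)) = 0"
        using W_decomposition[of \<xi> 1] elim that(1) mean_gt_1 by simp
      then show ?thesis
        using that(2) elim by (subst (asm) sum_nonneg_eq_0_iff) (auto simp: finite_generation W_nonneg)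
    qed
    then show ?case by (auto simp: h_def B_def indicator_def intro!: prod.neutral[symmetric])
  qed
  then have "(\<integral>\<^sup>+\<xi>. indicator B \<xi> \<partial>env p) \<le> (\<integral>\<^sup>+\<xi>. h (G 1 \<xi>) \<xi> \<partial>env p)"
    by (rule nn_integral_mono_AE)
  then have "ennreal q \<le> (\<integral>\<^sup>+\<xi>. h (G 1 \<xi>) \<xi> \<partial>env p)" by (simp add: em)
  also have "\<dots> = (\<integral>\<^sup>+\<xi>. (\<integral>\<^sup>+\<zeta>. h (G 1 \<xi>) \<zeta> \<partial>env p) \<partial>env p)"
  proof (rule nn_integral_generation)
    fix A :: "nat list set" assume A: "A \<subseteq> {v. length v = 1}"
    show "h A \<in> borel_measurable (env p)"
      unfolding h_def[abs_def]
      by (intro borel_measurable_prod_ennreal measurable_compose[OF measurable_subenv]) measurable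
    have "subenv v \<xi> = subenv v \<zeta>" if "v \<in> A" "\<forall>u\<in>{u. 1 \<le> length u}. \<xi> u = \<zeta> u"
      for v and \<xi> \<zeta> :: "nat list \<Rightarrow> nat"
      using that A by (auto simp: subenv_def)
    then show "depends_on {u. 1 \<le> length u} (h A)"
      unfolding depends_on_def h_def by (intro allI impI prod.cong arg_cong[where f = "indicator B"]) auto
  qed
  also have "\<dots> = (\<integral>\<^sup>+\<xi>. ennreal (q ^ \<xi> []) \<partial>env p)"
  proof (intro nn_integral_cong)
    fix \<xi>
    have "(\<integral>\<^sup>+\<zeta>. h (G 1 \<xi>) \<zeta> \<partial>env p) = (\<Prod>v\<in>G 1 \<xi>. \<integral>\<^sup>+\<zeta>. indicator B \<zeta> \<partial>env p)"
      unfolding h_def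
      by (rule nn_integral_prod_subenv[where n = 1]) (auto simp: finite_generation, auto simp: generation_def)
    also have "\<dots> = ennreal q ^ card (G 1 \<xi>)" by (simp add: em)
    also have "\<dots> = ennreal (q ^ \<xi> [])"
      using gen_size_1[of \<xi>] q01 by (simp add: gen_size_def ennreal_power)
    finally show "(\<integral>\<^sup>+\<zeta>. h (G 1 \<xi>) \<zeta> \<partial>env p) = ennreal (q ^ \<xi> [])" .
  qed
  also have "\<dots> = (\<integral>\<^sup>+k. ennreal (q ^ k) \<partial>measure_pmf p)"
    by (rule nn_integral_env_coord)
  also have "\<dots> = ennreal (measure_pmf.expectation p (\<lambda>k. q ^ k))"
    using q01 by (intro nn_integral_eq_integral measure_pmf.integrable_const_bound[where B = 1])
      (auto simp: power_le_one)
  finally have q_le: "q \<le> measure_pmf.expectation p (\<lambda>k. q ^ k)"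
    using q01 by (simp add: ennreal_le_iff integral_nonneg_AE)
  have int: "integrable (measure_pmf p) (\<lambda>k. q - q ^ k)"
    using q01 by (intro Bochner_Integration.integrable_diff measure_pmf.integrable_const_bound[where B = 1])
      (auto simp: power_le_one)
  \<comment> \<open>Offspring numbers in the support are at least 1, so \<open>q ^ k \<le> q\<close>
    there. Together with \<open>q_le\<close> this forces equality almost surely.\<close>
  have nonneg: "AE k in measure_pmf p. 0 \<le> q - q ^ k"
    unfolding AE_measure_pmf_iff
  proof
    fix k assume "k \<in> set_pmf p"
    then have "1 \<le> k" using min_offspring_le min_offspring_ge_1 order_trans by blast
    then show "0 \<le> q - q ^ k" using power_decreasing[of 1 k q] q01 by simp
  qed
  have "measure_pmf.expectation p (\<lambda>k. q - q ^ k) = q - measure_pmf.expectation p (\<lambda>k. q ^ k)"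
    using q01 by (subst Bochner_Integration.integral_diff)
      (auto intro!: measure_pmf.integrable_const_bound[where B = 1] simp: power_le_one)
  with q_le integral_nonneg_AE[OF nonneg] have "measure_pmf.expectation p (\<lambda>k. q - q ^ k) = 0"
    by linarith
  then have "AE k in measure_pmf p. q - q ^ k = 0"
    using integral_nonneg_eq_0_iff_AE[OF int nonneg] by blast
  \<comment> \<open>An offspring number exceeding \<open>\<mu>\<close> is at least 2, and
    \<open>q = q ^ k\<close> then leaves only the values 0 and 1.\<close>
  moreover obtain k where k: "k \<in> set_pmf p" "\<mu> < k" using ex_offspring_gt by blast
  ultimately have qk: "q = q ^ k" by (simp add: AE_measure_pmf_iff)
  have "q \<noteq> 1"
  proof
    assume "q = 1"
    then have "AE \<xi> in env p. \<xi> \<in> B"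
      by (subst E.prob_eq_1[symmetric]) (auto simp: q_def B_def)
    then show False using not_AE_W_eq_0 by (simp add: B_def)
  qed
  moreover have "2 \<le> k" using k min_offspring_ge_1 by linarith
  then have "q ^ k \<le> q ^ 2" using q01 by (intro power_decreasing) auto
  then have "q * (1 - q) \<le> 0" using qk by (simp add: power2_eq_square algebra_simps)
  ultimately have "q = 0" using q01 by (auto simp: mult_le_0_iff)
  then have "AE \<xi> in env p. \<xi> \<notin> B"
    by (subst E.prob_eq_0[symmetric]) (auto simp: q_def B_def)
  then show ?thesis
    using AE_convergent_env by eventually_elim (auto simp: B_def less_le W_nonneg)
qed

definition F :: "real \<Rightarrow> real" where
  "F x = E.prob {\<xi>. W \<xi> < x}"

lemma F_mono: "x \<le> y \<Longrightarrow> F x \<le> F y"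
  unfolding F_def by (intro E.finite_measure_mono W_event) auto

text \<open>Along \<open>1 / Suc n\<close> the events decrease to a null event because
  \<open>W\<close> is almost surely positive; monotonicity of \<open>F\<close> covers the remaining
  arguments.\<close>

lemma F_tendsto_0: "(F \<longlongrightarrow> 0) (at_right 0)"
proof -
  let ?A = "\<lambda>n. {\<xi>. W \<xi> < 1 / real (Suc n)}"
  have "(\<lambda>n. E.prob (?A n)) \<longlonglongrightarrow> E.prob (\<Inter>n. ?A n)"
  proof (rule E.finite_Lim_measure_decseq)
    show "decseq ?A"
      unfolding decseq_def
    proof (intro allI impI)
      fix m n :: nat assume "m \<le> n"
      then have "1 / real (Suc n) \<le> 1 / real (Suc m)" by (intro frac_le) auto
      then show "?A n \<subseteq> ?A m" by auto
    qed
  qed (auto simp: W_event)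
  moreover have "E.prob (\<Inter>n. ?A n) = 0"
  proof (subst E.prob_eq_0)
    show "AE \<xi> in env p. \<xi> \<notin> (\<Inter>n. ?A n)"
      using AE_W_pos
    proof eventually_elim
      case (elim \<xi>)
      then obtain n where "1 / real (Suc n) < W \<xi>" using nat_approx_posE by blast
      then show ?case by (auto intro!: exI[of _ n])
    qed
  qed (auto simp: W_event)
  ultimately have lim: "(\<lambda>n. F (1 / real (Suc n))) \<longlonglongrightarrow> 0" by (simp add: F_def)
  show ?thesis
  proof (rule tendstoI)
    fix e :: real assume "0 < e"
    then have "\<forall>\<^sub>F n in sequentially. F (1 / real (Suc n)) < e"
      using lim by (auto dest: order_tendstoD)
    then obtain n where n: "F (1 / real (Suc n)) < e"
      unfolding eventually_sequentially by blast
    have "dist (F x) 0 < e" if "x < 1 / real (Suc n)" for x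
      using F_mono[of x "1 / real (Suc n)"] n that by (simp add: F_def)
    then show "\<forall>\<^sub>F x in at_right 0. dist (F x) 0 < e"
      unfolding eventually_at_right_field by (intro exI[of _ "1 / real (Suc n)"]) auto
  qed
qed

section \<open>Comparison with the regular tree at generation \<open>n\<close>\<close>

abbreviation A\<^sub>0 :: "nat \<Rightarrow> nat list set" where
  "A\<^sub>0 n \<equiv> generation n (regular_tree \<mu>)"

lemma A0_subset: "A\<^sub>0 n \<subseteq> {v. length v = n}"
  by (auto simp: generation_def)

text \<open>The sum runs over a fixed set, not over the random generation. Hence \<open>S n\<close>
  is independent of generation \<open>n\<close>, and it equals \<open>a ^ n * W\<close> almost
  surely when that generation is regular.\<close>

definition S :: "nat \<Rightarrow> (nat list \<Rightarrow> nat) \<Rightarrow> real" where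
  "S n \<xi> = (\<Sum>v\<in>A\<^sub>0 n. W (subenv v \<xi>))"

lemma measurable_S [measurable]: "S n \<in> borel_measurable (env p)"
  unfolding S_def[abs_def] by measurable

lemma S_event [measurable]: "{\<xi>. S n \<xi> < x} \<in> sets (env p)"
  using measurable_sets[OF measurable_S, of "{..<x}"] by (simp add: vimage_def)

lemma depends_on_S: "depends_on (\<Union>v\<in>A\<^sub>0 n. range ((@) v)) (S n)"
  unfolding depends_on_def S_def
  by (intro allI impI sum.cong arg_cong[where f = W] depends_onD[OF depends_on_subenv]) auto

lemma generation_event_sets [measurable]: "{\<xi>. G n \<xi> = A} \<in> sets (env p)"
  using generation_eq_event[where p = p and n = n and A = A] by (simp add: pred_def)

text \<open>The event contains the one where all vertices of the regular tree before generation
  \<open>n\<close> have exactly \<open>\<mu>\<close> children. Its probability is a finite product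
  of positive numbers.\<close>

lemma prob_regular_pos: "0 < E.prob {\<xi>. G n \<xi> = A\<^sub>0 n}"
proof -
  define U where "U = (\<Union>k<n. A\<^sub>0 k)"
  have U: "finite U" by (simp add: U_def finite_generation)
  have "ennreal (pmf p \<mu> ^ card U) = (\<Prod>u\<in>U. emeasure (measure_pmf p) {\<mu>})"
    by (simp add: emeasure_pmf_single ennreal_power)
  also have "\<dots> = (\<Prod>u\<in>U. \<integral>\<^sup>+\<xi>. indicator {\<mu>} (\<xi> u) \<partial>env p)"
    by (simp add: nn_integral_env_coord[where f = "indicator {\<mu>}"])
  also have "\<dots> = (\<integral>\<^sup>+\<xi>. (\<Prod>u\<in>U. indicator {\<mu>} (\<xi> u)) \<partial>env p)"
    using U by (intro nn_integral_PiM_prod_depends_on[where K = "\<lambda>u. {u}", symmetric])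
      (auto simp: prob_space_measure_pmf depends_on_def disjoint_family_on_def
        intro: measurable_compose[OF measurable_env_coord])
  also have "\<dots> \<le> (\<integral>\<^sup>+\<xi>. indicator {\<xi>. G n \<xi> = A\<^sub>0 n} \<xi> \<partial>env p)"
  proof (intro nn_integral_mono)
    fix \<xi> :: "nat list \<Rightarrow> nat"
    show "(\<Prod>u\<in>U. indicator {\<mu>} (\<xi> u)) \<le> (indicator {\<xi>. G n \<xi> = A\<^sub>0 n} \<xi> :: ennreal)"
    proof (cases "\<forall>u\<in>U. \<xi> u = \<mu>")
      case True
      then have "G n \<xi> = A\<^sub>0 n" by (intro generation_eq_regular) (auto simp: U_def)
      then show ?thesis using True by simp
    next
      case False
      then have *: "(\<Prod>u\<in>U. indicator {\<mu>} (\<xi> u)) = (0 :: ennreal)"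
        using U by (intro prod_zero) (auto simp: indicator_def)
      show ?thesis unfolding * by simp
    qed
  qed
  also have "\<dots> = ennreal (E.prob {\<xi>. G n \<xi> = A\<^sub>0 n})"
    by (simp add: E.emeasure_eq_measure)
  finally have "pmf p \<mu> ^ card U \<le> E.prob {\<xi>. G n \<xi> = A\<^sub>0 n}"
    by (simp add: ennreal_le_iff)
  then show ?thesis using pmf_min_offspring by (meson less_le_trans zero_less_power)
qed

text \<open>Regularity of generation \<open>n\<close> and smallness of \<open>S n\<close> are
  independent, and together they imply \<open>W \<xi> < \<epsilon>\<close> outside a null
  set.\<close>

lemma prob_W_less_ge:
  "E.prob {\<xi>. G n \<xi> = A\<^sub>0 n} * E.prob {\<xi>. S n \<xi> < a ^ n * \<epsilon>} \<le> F \<epsilon>"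
proof -
  let ?f = "indicator {\<xi>. G n \<xi> = A\<^sub>0 n} :: _ \<Rightarrow> ennreal"
  let ?g = "indicator {\<xi>. S n \<xi> < a ^ n * \<epsilon>} :: _ \<Rightarrow> ennreal"
  have "(\<integral>\<^sup>+\<xi>. ?f \<xi> \<partial>env p) * (\<integral>\<^sup>+\<xi>. ?g \<xi> \<partial>env p) = (\<integral>\<^sup>+\<xi>. ?f \<xi> * ?g \<xi> \<partial>env p)"
  proof (rule nn_integral_PiM_mult_depends_on[symmetric])
    show "depends_on {u. length u < n} ?f"
      by (rule depends_on_indicator[OF depends_on_generation])
    show "depends_on (\<Union>v\<in>A\<^sub>0 n. range ((@) v)) ?g"
      by (rule depends_on_indicator[OF depends_on_S])
    show "{u. length u < n} \<inter> (\<Union>v\<in>A\<^sub>0 n. range ((@) v)) = {}"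
      using A0_subset[of n] by auto
  qed (auto simp: prob_space_measure_pmf)
  also have "\<dots> \<le> (\<integral>\<^sup>+\<xi>. indicator {\<xi>. W \<xi> < \<epsilon>} \<xi> \<partial>env p)"
  proof (rule nn_integral_mono_AE)
    show "AE \<xi> in env p. ?f \<xi> * ?g \<xi> \<le> indicator {\<xi>. W \<xi> < \<epsilon>} \<xi>"
      using AE_good
    proof eventually_elim
      case (elim \<xi>)
      have "W \<xi> < \<epsilon>" if "G n \<xi> = A\<^sub>0 n" "S n \<xi> < a ^ n * \<epsilon>"
        using that elim by (simp add: W_less_iff[where n = n] S_def)
      then show ?case by (auto simp: indicator_def)
    qed
  qed
  finally show ?thesis
    by (simp add: E.emeasure_eq_measure F_def W_event S_event generation_event_sets
        ennreal_mult[symmetric] ennreal_le_iff)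
qed

text \<open>If generation \<open>n\<close> strictly contains the regular one, an additional vertex
  has a subtree limit below the same level. Its subtree is disjoint from those entering
  \<open>S n\<close>, so it supplies a further factor.\<close>

lemma prob_W_less_not_regular_le:
  "E.prob {\<xi>. W \<xi> < \<epsilon> \<and> G n \<xi> \<noteq> A\<^sub>0 n} \<le> E.prob {\<xi>. S n \<xi> < a ^ n * \<epsilon>} * F (a ^ n * \<epsilon>)"
proof -
  define x where "x = a ^ n * \<epsilon>"
  \<comment> \<open>The additional vertex is a function of the set \<open>A\<close> alone; once
    \<open>A\<close> is fixed it is a fixed word, to which independence applies.\<close>
  define u where "u A = (SOME v. v \<in> A - A\<^sub>0 n)" for A
  let ?f = "indicator {\<xi>. S n \<xi> < x} :: _ \<Rightarrow> ennreal"
  let ?g = "\<lambda>v \<xi>. indicator {\<xi>. W \<xi> < x} (subenv v \<xi>) :: ennreal"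
  define h where "h A \<xi> = (if A\<^sub>0 n \<subset> A then ?f \<xi> * ?g (u A) \<xi> else 0)" for A \<xi>
  have g_meas: "?g v \<in> borel_measurable (env p)" for v
    by (rule measurable_compose[OF measurable_subenv]) measurable
  have f_dep: "depends_on (\<Union>v\<in>A\<^sub>0 n. range ((@) v)) ?f"
    by (rule depends_on_indicator[OF depends_on_S])
  have g_dep: "depends_on (range ((@) v)) (?g v)" for v
    by (rule depends_on_comp[OF depends_on_subenv])
  have u: "u A \<in> A - A\<^sub>0 n" if "A\<^sub>0 n \<subset> A" for A
    unfolding u_def by (rule someI_ex[of "\<lambda>v. v \<in> A - A\<^sub>0 n"]) (use that in blast)
  have h_int: "(\<integral>\<^sup>+\<zeta>. h A \<zeta> \<partial>env p)
      \<le> ennreal (E.prob {\<xi>. S n \<xi> < x}) * ennreal (F x)" if A: "A \<subseteq> {v. length v = n}" for A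
  proof (cases "A\<^sub>0 n \<subset> A")
    case True
    have "(\<integral>\<^sup>+\<zeta>. h A \<zeta> \<partial>env p) = (\<integral>\<^sup>+\<zeta>. ?f \<zeta> * ?g (u A) \<zeta> \<partial>env p)"
      using True by (simp add: h_def)
    also have "\<dots> = (\<integral>\<^sup>+\<zeta>. ?f \<zeta> \<partial>env p) * (\<integral>\<^sup>+\<zeta>. ?g (u A) \<zeta> \<partial>env p)"
    proof (rule nn_integral_PiM_mult_depends_on[OF _ _ _ f_dep g_meas g_dep])
      have "range ((@) v) \<inter> range ((@) (u A)) = {}" if "v \<in> A\<^sub>0 n" for v
        using u[OF True] A that by (intro disjoint_ranges_append) (auto simp: generation_def)
      then show "(\<Union>v\<in>A\<^sub>0 n. range ((@) v)) \<inter> range ((@) (u A)) = {}" by blast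
    qed (auto simp: prob_space_measure_pmf)
    also have "(\<integral>\<^sup>+\<zeta>. ?g (u A) \<zeta> \<partial>env p) = (\<integral>\<^sup>+\<zeta>. indicator {\<xi>. W \<xi> < x} \<zeta> \<partial>env p)"
      by (rule nn_integral_subenv) measurable
    finally show ?thesis
      by (simp add: E.emeasure_eq_measure F_def W_event S_event)
  qed (simp add: h_def)
  have "(\<integral>\<^sup>+\<xi>. indicator {\<xi>. W \<xi> < \<epsilon> \<and> G n \<xi> \<noteq> A\<^sub>0 n} \<xi> \<partial>env p) \<le> (\<integral>\<^sup>+\<xi>. h (G n \<xi>) \<xi> \<partial>env p)"
  proof (rule nn_integral_mono_AE)
    show "AE \<xi> in env p. indicator {\<xi>. W \<xi> < \<epsilon> \<and> G n \<xi> \<noteq> A\<^sub>0 n} \<xi> \<le> h (G n \<xi>) \<xi>"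
      using AE_good
    proof eventually_elim
      case (elim \<xi>)
      have nonneg: "0 \<le> W (subenv v \<xi>)" for v using elim by (simp add: W_nonneg)
      \<comment> \<open>On the good event every offspring number is at least \<open>\<mu>\<close>,
        so the actual generation contains the regular one.\<close>
      have "A\<^sub>0 n \<subseteq> G n \<xi>"
        unfolding regular_tree_def by (rule generation_mono) (use elim min_offspring_le in auto)
      moreover have "S n \<xi> < x \<and> W (subenv (u (G n \<xi>)) \<xi>) < x"
        if "W \<xi> < \<epsilon>" "A\<^sub>0 n \<subset> G n \<xi>"
      proof -
        have "(\<Sum>v\<in>G n \<xi>. W (subenv v \<xi>)) < x"
          using that(1) elim by (simp add: W_less_iff[where n = n] x_def)
        moreover have "S n \<xi> \<le> (\<Sum>v\<in>G n \<xi>. W (subenv v \<xi>))"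
          unfolding S_def using that(2) nonneg by (intro sum_mono2) (auto simp: finite_generation)
        moreover have "W (subenv (u (G n \<xi>)) \<xi>) \<le> (\<Sum>v\<in>G n \<xi>. W (subenv v \<xi>))"
          using u[OF that(2)] nonneg by (intro member_le_sum) (auto simp: finite_generation)
        ultimately show ?thesis by linarith
      qed
      ultimately show ?case
        by (cases "W \<xi> < \<epsilon> \<and> G n \<xi> \<noteq> A\<^sub>0 n") (auto simp: h_def psubset_eq)
    qed
  qed
  also have "\<dots> = (\<integral>\<^sup>+\<xi>. (\<integral>\<^sup>+\<zeta>. h (G n \<xi>) \<zeta> \<partial>env p) \<partial>env p)"
  proof (rule nn_integral_generation)
    fix A :: "nat list set" assume A: "A \<subseteq> {v. length v = n}"
    show "h A \<in> borel_measurable (env p)"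
      unfolding h_def[abs_def] using g_meas by (cases "A\<^sub>0 n \<subset> A") auto
    have 1: "depends_on {u. n \<le> length u} ?f"
      by (rule depends_on_mono[OF f_dep]) (use A0_subset[of n] in auto)
    have 2: "depends_on {u. n \<le> length u} (?g v)" if "length v = n" for v
      by (rule depends_on_mono[OF g_dep]) (use that in auto)
    show "depends_on {u. n \<le> length u} (h A)"
    proof (cases "A\<^sub>0 n \<subset> A")
      case True
      then have "length (u A) = n" using u[OF True] A by auto
      note 2 = 2[OF this]
      have "h A = (\<lambda>\<xi>. ?f \<xi> * ?g (u A) \<xi>)" using True by (simp add: h_def fun_eq_iff)
      moreover have "depends_on {u. n \<le> length u} (\<lambda>\<xi>. ?f \<xi> * ?g (u A) \<xi>)"
        by (rule depends_on_comp2[OF 1 2])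
      ultimately show ?thesis by simp
    qed (simp add: depends_on_def h_def)
  qed
  also have "\<dots> \<le> (\<integral>\<^sup>+\<xi>. ennreal (E.prob {\<xi>. S n \<xi> < x}) * ennreal (F x) \<partial>env p)"
    by (intro nn_integral_mono h_int) (auto simp: generation_def)
  also have "\<dots> = ennreal (E.prob {\<xi>. S n \<xi> < x} * F x)"
    using E.emeasure_space_1 by (simp add: ennreal_mult F_def)
  finally have "(\<integral>\<^sup>+\<xi>. indicator {\<xi>. W \<xi> < \<epsilon> \<and> G n \<xi> \<noteq> A\<^sub>0 n} \<xi> \<partial>env p)
    \<le> ennreal (E.prob {\<xi>. S n \<xi> < x} * F x)" .
  moreover have "{\<xi>. W \<xi> < \<epsilon>} - {\<xi>. G n \<xi> = A\<^sub>0 n} \<in> sets (env p)"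
    by (intro sets.Diff W_event generation_event_sets)
  then have "{\<xi>. W \<xi> < \<epsilon> \<and> G n \<xi> \<noteq> A\<^sub>0 n} \<in> sets (env p)"
    by (rule back_subst[where P = "\<lambda>X. X \<in> sets (env p)"]) blast
  ultimately have "ennreal (E.prob {\<xi>. W \<xi> < \<epsilon> \<and> G n \<xi> \<noteq> A\<^sub>0 n})
      \<le> ennreal (E.prob {\<xi>. S n \<xi> < x} * F x)"
    by (simp add: E.emeasure_eq_measure)
  then show ?thesis
    unfolding x_def by (subst (asm) ennreal_le_iff) (simp_all add: F_def)
qed

text \<open>Since \<open>\<mu> < a\<close>, the requirement that all \<open>\<mu>\<^sup>n\<close> subtrees of generation \<open>n\<close> of the regular tree
  have limit below a fixed level \<open>K\<close> forces \<open>W\<close> below \<open>K (\<mu> / a)\<^sup>n\<close>.\<close>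

lemma F_pos:
  assumes "0 < \<epsilon>"
  shows "0 < F \<epsilon>"
proof -
  \<comment> \<open>Since \<open>W\<close> is real-valued, some level \<open>k\<close> bounds it
    with positive probability.\<close>
  have "(\<lambda>k. E.prob {\<xi>. W \<xi> < real k}) \<longlonglongrightarrow> E.prob (\<Union>k. {\<xi>. W \<xi> < real k})"
    by (rule E.finite_Lim_measure_incseq) (auto simp: W_event incseq_def intro: less_le_trans)
  moreover have "(\<Union>k. {\<xi>. W \<xi> < real k}) = UNIV" by (auto simp: reals_Archimedean2)
  ultimately have "(\<lambda>k. F (real k)) \<longlonglongrightarrow> 1" using E.prob_space by (simp add: F_def)
  then have "\<forall>\<^sub>F k in sequentially. 0 < F (real k)"
    by (rule order_tendstoD(1)) simp
  then obtain k where k: "0 < F (real k)" unfolding eventually_sequentially by blast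
  have "1 < a / real \<mu>" using min_offspring_less_mean min_offspring_ge_1 by (simp add: field_simps)
  \<comment> \<open>This \<open>n\<close> is chosen so that \<open>\<mu> ^ n\<close> limits below
    \<open>k\<close> sum to less than \<open>a ^ n * \<epsilon>\<close>.\<close>
  then obtain n where "real k / \<epsilon> < (a / real \<mu>) ^ n" using real_arch_pow by blast
  then have n: "real (\<mu> ^ n) * real k < a ^ n * \<epsilon>"
    using assms min_offspring_ge_1 by (simp add: field_simps power_divide)
  have "ennreal (F (real k) ^ card (A\<^sub>0 n)) = (\<Prod>v\<in>A\<^sub>0 n. \<integral>\<^sup>+\<xi>. indicator {\<xi>. W \<xi> < real k} \<xi> \<partial>env p)"
    by (simp add: E.emeasure_eq_measure F_def W_event ennreal_power)
  also have "\<dots> = (\<integral>\<^sup>+\<xi>. (\<Prod>v\<in>A\<^sub>0 n. indicator {\<xi>. W \<xi> < real k} (subenv v \<xi>)) \<partial>env p)"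
    by (intro nn_integral_prod_subenv[symmetric, where n = n] finite_generation A0_subset) measurable
  also have "\<dots> \<le> (\<integral>\<^sup>+\<xi>. indicator {\<xi>. S n \<xi> < a ^ n * \<epsilon>} \<xi> \<partial>env p)"
  proof (intro nn_integral_mono)
    fix \<xi>
    show "(\<Prod>v\<in>A\<^sub>0 n. indicator {\<xi>. W \<xi> < real k} (subenv v \<xi>))
        \<le> (indicator {\<xi>. S n \<xi> < a ^ n * \<epsilon>} \<xi> :: ennreal)"
    proof (cases "\<forall>v\<in>A\<^sub>0 n. W (subenv v \<xi>) < real k")
      case True
      have "S n \<xi> \<le> real (card (A\<^sub>0 n)) * real k"
        unfolding S_def using True by (intro sum_bounded_above) (auto intro: less_imp_le)
      then have "S n \<xi> < a ^ n * \<epsilon>" using n by (simp add: card_generation_regular)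
      then show ?thesis using True by simp
    next
      case False
      then have *: "(\<Prod>v\<in>A\<^sub>0 n. indicator {\<xi>. W \<xi> < real k} (subenv v \<xi>)) = (0 :: ennreal)"
        by (intro prod_zero finite_generation) (auto simp: indicator_def)
      show ?thesis unfolding * by simp
    qed
  qed
  also have "\<dots> = ennreal (E.prob {\<xi>. S n \<xi> < a ^ n * \<epsilon>})"
    by (simp add: E.emeasure_eq_measure S_event)
  finally have "F (real k) ^ card (A\<^sub>0 n) \<le> E.prob {\<xi>. S n \<xi> < a ^ n * \<epsilon>}"
    by (simp add: ennreal_le_iff)
  then have "0 < E.prob {\<xi>. S n \<xi> < a ^ n * \<epsilon>}"
    using k by (meson less_le_trans zero_less_power)
  then have "0 < E.prob {\<xi>. G n \<xi> = A\<^sub>0 n} * E.prob {\<xi>. S n \<xi> < a ^ n * \<epsilon>}"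
    using prob_regular_pos by simp
  then show ?thesis using prob_W_less_ge by (rule less_le_trans)
qed

text \<open>The probability that \<open>S n\<close> is small occurs both in the upper bound for the
  numerator and in the lower bound for \<open>F \<epsilon>\<close>, and cancels. What remains tends
  to 0 with \<open>F\<close>.\<close>

lemma conditional_not_regular_tendsto_0:
  "((\<lambda>\<epsilon>. E.prob {\<xi>. W \<xi> < \<epsilon> \<and> G n \<xi> \<noteq> A\<^sub>0 n} / F \<epsilon>) \<longlongrightarrow> 0) (at_right 0)"
proof (rule tendsto_sandwich[OF _ _ tendsto_const])
  let ?\<pi> = "E.prob {\<xi>. G n \<xi> = A\<^sub>0 n}"
  have "E.prob {\<xi>. W \<xi> < \<epsilon> \<and> G n \<xi> \<noteq> A\<^sub>0 n} / F \<epsilon> \<le> F (a ^ n * \<epsilon>) / ?\<pi>" if "0 < \<epsilon>" for \<epsilon>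
  proof -
    let ?s = "E.prob {\<xi>. S n \<xi> < a ^ n * \<epsilon>}" and ?y = "F (a ^ n * \<epsilon>)"
    have "?\<pi> * E.prob {\<xi>. W \<xi> < \<epsilon> \<and> G n \<xi> \<noteq> A\<^sub>0 n} \<le> ?\<pi> * (?s * ?y)"
      by (intro mult_left_mono prob_W_less_not_regular_le) simp
    also have "\<dots> = (?\<pi> * ?s) * ?y" by simp
    also have "\<dots> \<le> F \<epsilon> * ?y"
      by (intro mult_right_mono prob_W_less_ge) (simp add: F_def)
    finally show ?thesis
      using F_pos[OF that] prob_regular_pos[of n] by (simp add: field_simps)
  qed
  then show "\<forall>\<^sub>F \<epsilon> in at_right 0.
      E.prob {\<xi>. W \<xi> < \<epsilon> \<and> G n \<xi> \<noteq> A\<^sub>0 n} / F \<epsilon> \<le> F (a ^ n * \<epsilon>) / ?\<pi>"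
    by (auto simp: eventually_at_right_field intro!: exI[of _ 1])
  show "\<forall>\<^sub>F \<epsilon> in at_right 0. 0 \<le> E.prob {\<xi>. W \<xi> < \<epsilon> \<and> G n \<xi> \<noteq> A\<^sub>0 n} / F \<epsilon>"
    by (simp add: F_def)
  have "filterlim (\<lambda>\<epsilon>. a ^ n * \<epsilon>) (at_right 0) (at_right 0)"
    using filterlim_times_pos[OF filterlim_ident, of "a ^ n" 0] mean_gt_1 by simp
  then have "((\<lambda>\<epsilon>. F (a ^ n * \<epsilon>)) \<longlongrightarrow> 0) (at_right 0)"
    by (rule filterlim_compose[OF F_tendsto_0])
  then show "((\<lambda>\<epsilon>. F (a ^ n * \<epsilon>) / ?\<pi>) \<longlongrightarrow> 0) (at_right 0)"
    using tendsto_divide_zero by blast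
qed

end

subsection \<open>Weak convergence\<close>

text \<open>Near \<open>z\<close> the test function varies little, and the mass away from
  \<open>z\<close> vanishes. The conditions on \<open>\<nu>\<close> are eventual because conditional
  laws given a small limit are considered for positive levels.\<close>

lemma converges_in_law_returnI:
  fixes \<nu> :: "'i \<Rightarrow> 'b :: metric_space measure"
  assumes \<nu>: "\<forall>\<^sub>F i in I. prob_space (\<nu> i) \<and> sets (\<nu> i) = sets borel"
    and lim: "\<And>\<delta>. 0 < \<delta> \<Longrightarrow> ((\<lambda>i. measure (\<nu> i) {x. \<delta> \<le> dist x z}) \<longlongrightarrow> 0) I"
  shows "converges_in_law \<nu> (return borel z) I"
  unfolding converges_in_law_def
proof (intro allI impI, elim conjE)
  fix f :: "'b \<Rightarrow> real"
  assume cont: "continuous_on UNIV f" and "bounded (range f)"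
  then obtain B where B: "\<And>x. \<bar>f x\<bar> \<le> B" by (auto simp: bounded_iff)
  have f_meas: "f \<in> borel_measurable borel" using cont by (rule borel_measurable_continuous_onI)
  have B0: "0 \<le> B" using B[of z] by linarith
  show "((\<lambda>i. integral\<^sup>L (\<nu> i) f) \<longlongrightarrow> integral\<^sup>L (return borel z) f) I"
  proof (rule tendstoI)
    fix e :: real assume e: "0 < e"
    obtain \<delta> where \<delta>: "0 < \<delta>" "\<And>x. dist x z < \<delta> \<Longrightarrow> dist (f x) (f z) < e / 2"
      using cont e unfolding continuous_on_iff by (metis UNIV_I half_gt_zero)
    define A where "A = {x. \<delta> \<le> dist x z}"
    have "closed A" unfolding A_def by (intro closed_Collect_le continuous_intros)
    then have A: "A \<in> sets borel" by simp
    \<comment> \<open>The denominator \<open>4 * B + 1\<close> makes \<open>2 * B\<close> times this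
      bound less than \<open>e / 2\<close>, and it is positive also when
      \<open>B = 0\<close>.\<close>
    have "\<forall>\<^sub>F i in I. measure (\<nu> i) A < e / (4 * B + 1)"
      using lim[OF \<delta>(1)] e B0 unfolding A_def by (intro order_tendstoD(2)[where a = "e / (4 * B + 1)"]) auto
    with \<nu> show "\<forall>\<^sub>F i in I. dist (integral\<^sup>L (\<nu> i) f) (integral\<^sup>L (return borel z) f) < e"
    proof eventually_elim
      case (elim i)
      interpret prob_space "\<nu> i" using elim by simp
      have sets: "sets (\<nu> i) = sets borel" using elim by simp
      have space: "space (\<nu> i) = UNIV" using sets_eq_imp_space_eq[OF sets] by simp
      have f_int: "integrable (\<nu> i) f"
        by (rule integrable_const_bound[where B = B])
          (use B f_meas in \<open>auto simp: measurable_cong_sets[OF sets refl]\<close>)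
      have "\<bar>integral\<^sup>L (\<nu> i) f - f z\<bar> = \<bar>\<integral>x. f x - f z \<partial>\<nu> i\<bar>"
        using f_int by (simp add: prob_space)
      also have "\<dots> \<le> (\<integral>x. \<bar>f x - f z\<bar> \<partial>\<nu> i)" by (rule integral_abs_bound)
      \<comment> \<open>On \<open>A\<close> the difference is at most \<open>2 * B\<close>, off
        \<open>A\<close> it is at most \<open>e / 2\<close>.\<close>
      also have "\<dots> \<le> (\<integral>x. e / 2 + 2 * B * indicator A x \<partial>\<nu> i)"
      proof (rule integral_mono)
        show "integrable (\<nu> i) (\<lambda>x. e / 2 + 2 * B * indicator A x)"
          using A by (intro Bochner_Integration.integrable_add integrable_const integrable_mult_right
              integrable_real_indicator) (auto simp: sets emeasure_eq_measure)
        show "\<bar>f x - f z\<bar> \<le> e / 2 + 2 * B * indicator A x" for x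
        proof (cases "x \<in> A")
          case True
          then show ?thesis using B[of x] B[of z] e by simp
        next
          case False
          then show ?thesis using \<delta>(2)[of x] by (simp add: A_def dist_real_def)
        qed
      qed (use f_int in auto)
      also have "\<dots> = e / 2 + 2 * B * measure (\<nu> i) A"
        using A by (subst Bochner_Integration.integral_add)
          (auto simp: sets emeasure_eq_measure space prob_space[unfolded space])
      also have "2 * B * measure (\<nu> i) A \<le> 2 * B * (e / (4 * B + 1))"
        using elim B0 by (intro mult_left_mono) auto
      also have "\<dots> < e / 2" using e B0 by (simp add: field_simps)
      finally show ?case using f_meas by (simp add: integral_return dist_real_def)
    qed
  qed
qed

section \<open>Transfer from the product model to the given random tree\<close>

context nlogn_offspring
begin

context
  fixes M :: "'a measure" and T :: "'a \<Rightarrow> rtree"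
  assumes M: "prob_space M" and T: "galton_watson_tree M p T"
begin

lemma measurable_T [measurable]: "T \<in> borel_measurable M"
  using T by (simp add: galton_watson_tree_def)

text \<open>Only the law of \<open>T\<close> enters, so an event about \<open>T\<close> has the
  probability of the same event for \<open>tree_of\<close> in the product model.\<close>

lemma measure_T:
  assumes "C \<in> sets borel"
  shows "measure M {\<omega> \<in> space M. T \<omega> \<in> C} = E.prob {\<xi>. tree_of \<xi> \<in> C}"
proof -
  have "measure M {\<omega> \<in> space M. T \<omega> \<in> C} = measure (distr M borel T) C"
    using assms by (subst measure_distr) (auto intro!: arg_cong[where f = "measure M"])
  also have "distr M borel T = distr (env p) borel tree_of"
    using T by (simp add: galton_watson_tree_def galton_watson_law_def)
  also have "measure \<dots> C = E.prob {\<xi>. tree_of \<xi> \<in> C}"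
    using assms measurable_tree_of by (subst measure_distr) (auto intro!: arg_cong[where f = "measure (env p)"])
  finally show ?thesis .
qed

abbreviation cond_law :: "real \<Rightarrow> rtree measure" where
  "cond_law \<epsilon> \<equiv> conditional_law M {\<omega> \<in> space M. martingale_limit p (T \<omega>) < \<epsilon>} T"

lemma W_borel: "{t. martingale_limit p t < \<epsilon>} \<in> sets borel"
  by measurable

lemma measure_small_limit: "measure M {\<omega> \<in> space M. martingale_limit p (T \<omega>) < \<epsilon>} = F \<epsilon>"
  using measure_T[OF W_borel] by (simp add: F_def)

lemma prob_space_cond_law:
  assumes "0 < \<epsilon>"
  shows "prob_space (cond_law \<epsilon>)"
proof -
  interpret prob_space M by (rule M)
  let ?E = "{\<omega> \<in> space M. martingale_limit p (T \<omega>) < \<epsilon>}"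
  have "emeasure M ?E \<noteq> 0"
    using F_pos[OF assms] measure_small_limit[of \<epsilon>] by (simp add: emeasure_eq_measure)
  then have "prob_space (uniform_measure M ?E)"
    by (intro prob_space_uniform_measure) (simp_all add: emeasure_eq_measure)
  then show ?thesis
    unfolding conditional_law_def by (rule prob_space.prob_space_distr) simp
qed

lemma measure_cond_law:
  assumes "0 < \<epsilon>" and C: "C \<in> sets borel"
  shows "measure (cond_law \<epsilon>) C = E.prob {\<xi>. W \<xi> < \<epsilon> \<and> tree_of \<xi> \<in> C} / F \<epsilon>"
proof -
  interpret prob_space M by (rule M)
  let ?E = "{\<omega> \<in> space M. martingale_limit p (T \<omega>) < \<epsilon>}"
  have E: "?E \<in> events" by measurable
  have "measure (cond_law \<epsilon>) C = measure (uniform_measure M ?E) (T -` C \<inter> space M)"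
    unfolding conditional_law_def using C by (subst measure_distr) auto
  also have "\<dots> = prob (?E \<inter> (T -` C \<inter> space M)) / prob ?E"
    using F_pos[OF assms(1)] measure_small_limit[of \<epsilon>] measurable_sets[OF measurable_T C] E
    by (intro measure_uniform_measure) (simp_all add: emeasure_eq_measure)
  also have "?E \<inter> (T -` C \<inter> space M) = {\<omega> \<in> space M. T \<omega> \<in> {t. martingale_limit p t < \<epsilon>} \<inter> C}"
    by auto
  also have "prob \<dots> = E.prob {\<xi>. W \<xi> < \<epsilon> \<and> tree_of \<xi> \<in> C}"
    using measure_T[OF sets.Int[OF W_borel C]] by simp
  finally show ?thesis by (simp add: measure_small_limit)
qed

text \<open>A distance of at least \<open>\<delta>\<close> from the regular tree means a discrepancy
  in some generation up to \<open>n\<close>, where \<open>exp (- real n) < \<delta>\<close>. A union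
  bound over these finitely many generations reduces the claim to
  \<open>conditional_not_regular_tendsto_0\<close>.\<close>

lemma converges_in_law_cond_law:
  "converges_in_law cond_law (return borel (regular_tree \<mu>)) (at_right 0)"
proof (rule converges_in_law_returnI)
  let ?R = "regular_tree \<mu>"
  have pos: "\<forall>\<^sub>F \<epsilon> :: real in at_right 0. 0 < \<epsilon>" by (rule eventually_at_right_less)
  then show "\<forall>\<^sub>F \<epsilon> in at_right 0. prob_space (cond_law \<epsilon>) \<and> sets (cond_law \<epsilon>) = sets borel"
    by eventually_elim (intro conjI prob_space_cond_law, simp_all add: conditional_law_def)
  fix \<delta> :: real assume \<delta>: "0 < \<delta>"
  have "(\<lambda>n. exp (- real n)) \<longlonglongrightarrow> 0"
    by (intro filterlim_compose[OF exp_at_bot] filterlim_compose[OF filterlim_uminus_at_bot_at_top]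
        filterlim_real_sequentially)
  then have "\<forall>\<^sub>F n in sequentially. exp (- real n) < \<delta>" using \<delta> by (rule order_tendstoD(2))
  then obtain n where n: "exp (- real n) < \<delta>" unfolding eventually_sequentially by blast
  define C where "C k = {t. generation k t \<noteq> A\<^sub>0 k}" for k
  have C: "C k \<in> sets borel" for k
  proof -
    have "C k = - {t. generation k t = A\<^sub>0 k}" by (auto simp: C_def)
    then show ?thesis using open_generation_eq[of k "A\<^sub>0 k"] by simp
  qed
  have sub: "{t. \<delta> \<le> dist t ?R} \<subseteq> (\<Union>k\<le>n. C k)"
  proof
    fix t assume "t \<in> {t. \<delta> \<le> dist t ?R}"
    then have "\<not> coincide_upto n t ?R" using n dist_rtree_le_iff[of t ?R n] by auto
    then show "t \<in> (\<Union>k\<le>n. C k)" by (auto simp: coincide_upto_def C_def)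
  qed
  have le: "measure (cond_law \<epsilon>) {t. \<delta> \<le> dist t ?R}
      \<le> (\<Sum>k\<le>n. E.prob {\<xi>. W \<xi> < \<epsilon> \<and> G k \<xi> \<noteq> A\<^sub>0 k} / F \<epsilon>)" if "0 < \<epsilon>" for \<epsilon>
  proof -
    interpret P: prob_space "cond_law \<epsilon>" using that by (rule prob_space_cond_law)
    have sets: "sets (cond_law \<epsilon>) = sets borel" by (simp add: conditional_law_def)
    have "P.prob {t. \<delta> \<le> dist t ?R} \<le> P.prob (\<Union>k\<le>n. C k)"
      using C by (intro P.finite_measure_mono sub) (auto simp: sets)
    also have "\<dots> \<le> (\<Sum>k\<le>n. P.prob (C k))"
      using C by (intro P.finite_measure_subadditive_finite) (auto simp: sets)
    also have "\<dots> = (\<Sum>k\<le>n. E.prob {\<xi>. W \<xi> < \<epsilon> \<and> G k \<xi> \<noteq> A\<^sub>0 k} / F \<epsilon>)"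
      by (intro sum.cong refl) (subst measure_cond_law[OF that C], simp add: C_def)
    finally show ?thesis .
  qed
  have "\<forall>\<^sub>F \<epsilon> in at_right 0. measure (cond_law \<epsilon>) {t. \<delta> \<le> dist t ?R}
      \<le> (\<Sum>k\<le>n. E.prob {\<xi>. W \<xi> < \<epsilon> \<and> G k \<xi> \<noteq> A\<^sub>0 k} / F \<epsilon>)"
    using pos by eventually_elim (rule le)
  moreover have "((\<lambda>\<epsilon>. \<Sum>k\<le>n. E.prob {\<xi>. W \<xi> < \<epsilon> \<and> G k \<xi> \<noteq> A\<^sub>0 k} / F \<epsilon>) \<longlongrightarrow> 0) (at_right 0)"
    by (intro tendsto_null_sum conditional_not_regular_tendsto_0)
  ultimately show "((\<lambda>\<epsilon>. measure (cond_law \<epsilon>) {t. \<delta> \<le> dist t ?R}) \<longlongrightarrow> 0) (at_right 0)"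
    by (rule tendsto_sandwich[OF _ _ tendsto_const, rotated]) simp
qed

end

end

theorem corollary3:
  fixes M :: "'a measure" and p :: "nat pmf" and T :: "'a \<Rightarrow> rtree"
  assumes "prob_space M"
    and "galton_watson_tree M p T"
    and "\<forall>k. p \<noteq> return_pmf k"
    and "pmf p 0 = 0"
    and "integrable (measure_pmf p) (\<lambda>n. real n * ln (real n))"
  shows "converges_in_law
           (\<lambda>\<epsilon>. conditional_law M {\<omega> \<in> space M. martingale_limit p (T \<omega>) < \<epsilon>} T)
           (return borel (regular_tree (min_offspring p)))
           (at_right (0 :: real))"
proof -
  interpret nlogn_offspring p
    by unfold_locales (fact assms)+
  show ?thesis
    using assms(1,2) by (rule converges_in_law_cond_law)
qed

end
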